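(* Let $p_2$ and $p_3$ be primes with $3<p_2<p_3$, $p_2\equiv 1 \pmod 3$ and $p_3>3p_2$. Let $r_3$ be the remainder of $p_3$ upon division by $3p_2$, and put $N=\frac{7(p_2^2-1)}{9p_2}$. Then \[\mathrm{hw}(\Phi_{3p_2p_3})=\begin{cases} N(p_3-2)+\frac{4p_2-1}{3}, & \text{if } r_3=2,\\ N(p_3+2)-\frac{4p_2-1}{3}, & \text{if } r_3=3p_2-2.\end{cases}\]
   Context: $\Phi_n$ denotes the $n$-th cyclotomic polynomial. For a polynomial $f$, $\mathrm{hw}(f)$ (Hamming weight) denotes the number of nonzero terms (nonzero coefficients) of $f$. *)

theory Defs
  imports
    Complex_Main
    "HOL-Computational_Algebra.Primes"
    "HOL-Computational_Algebra.Polynomial"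
    "HOL-Number_Theory.Cong"
begin

definition primitive_roots_of_unity :: "nat \<Rightarrow> complex set" where
  "primitive_roots_of_unity n = {z. z ^ n = 1 \<and> (\<forall>m. 0 < m \<and> m < n \<longrightarrow> z ^ m \<noteq> 1)}"

(* Intended for n > 0.  The coefficients are in fact integers; the polynomial is kept over the
   complex numbers, where it is defined, as this does not affect which coefficients vanish. *)
definition cyclotomic :: "nat \<Rightarrow> complex poly" where
  "cyclotomic n = (\<Prod>z\<in>primitive_roots_of_unity n. [:- z, 1:])"

definition hw :: "'a::zero poly \<Rightarrow> nat" where
  "hw f = card {i. coeff f i \<noteq> 0}"

end

(* Since \<Phi>_{3pq}(x) = \<Phi>_{3p}(x^q) / \<Phi>_{3p}(x) and 1 / \<Phi>_{3p} has 3p-periodic coefficients, the n-th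
   coefficient of \<Phi>_{3pq} depends only on J = n div q and on n mod 3p.  If q = 3pk + 2, every block
   Jq <= n < Jq + q covers each residue k times and the residues 2J and 2J + 1 once more; these extra
   terms are exactly the coefficients for "q = 2", that is, those of \<Phi>_{3p}(x^2) / \<Phi>_{3p}(x) =
   \<Phi>_{3p}(-x), so (4p - 1)/3 of them are nonzero.  If q = 3pk - 2, reflecting residues turns the two
   missing terms of each block into the same extra terms.  It remains to count, over all J and one
   period, the nonzero values: for J < p - 1 they are a difference of two shifted copies of an
   explicit 6-periodic pattern, and the remaining J follow from the symmetry J -> 2p - 3 - J. *)
theory Submission
  imports Defs "HOL-Computational_Algebra.Computational_Algebra"
begin

section \<open>Cyclotomic polynomials as products of binomials\<close>

text \<open>In the series identities Phi_{3p} stands for the quotient (1 - x)(1 - x^(3p)) / ((1 -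
  x^3)(1 - x^p)); all identities are cleared of denominators and cancelled in the domain of power
  series. Since p is odd and 1 modulo 3, p = 6m + 1, so on a 6-periodic pattern a shift by p acts as
  a shift by one. The reflection rests on (1 + x + x^2)(1 - x^p) being antipalindromic of degree p +
  2: the map i -> p + 2 - i negates the coefficients of 1 / Phi_{3p}. Together with the palindromic
  Phi_{3p} and the vanishing of complete sums this also yields the symmetry in J. The constant N
  comes from the total over the 2p - 2 blocks, 84 m^2 + 28 m = 7 (p^2 - 1) / 3 = 3p N nonzero values
  per period of length 3p, so that k periods contribute N times 3pk.\<close>

lemma power_gcd_eq_one:
  fixes z :: "'a :: idom"
  assumes "z ^ a = 1" "z ^ b = 1"
  shows "z ^ gcd a b = 1"
proof (cases "a = 0")
  case True
  then show ?thesis using assms by simp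
next
  case False
  then obtain x y where xy: "a * x = b * y + gcd a b"
    using bezout_nat by blast
  have "z ^ (a * x) = 1" "z ^ (b * y) = 1"
    using assms by (simp_all add: power_mult)
  then show ?thesis using xy by (simp add: power_add)
qed

lemma roots_of_unity_Int:
  "{z::'a::idom. z ^ a = 1} \<inter> {z. z ^ b = 1} = {z. z ^ gcd a b = 1}"
proof (intro set_eqI iffI)
  fix z :: 'a
  assume z: "z \<in> {z. z ^ gcd a b = 1}"
  have "z ^ n = 1" if "gcd a b dvd n" for n
    using that z by (auto simp: power_mult)
  then have "z ^ a = 1" "z ^ b = 1" by auto
  then show "z \<in> {z. z ^ a = 1} \<inter> {z. z ^ b = 1}" by simp
qed (auto intro: power_gcd_eq_one)

text \<open>If z has a smaller exponent k, then it is a d-th root of unity for d = gcd k n, a proper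
  divisor of n; any prime l dividing n / d makes d a divisor of n / l. So only the maximal proper
  divisors need to be excluded.\<close>

lemma primitive_roots_of_unity_altdef:
  assumes "n > 0"
  shows "primitive_roots_of_unity n =
    {z. z ^ n = 1} - (\<Union>l\<in>prime_factors n. {z. z ^ (n div l) = 1})"
proof (intro set_eqI iffI)
  fix z
  assume z: "z \<in> primitive_roots_of_unity n"
  have "z ^ (n div l) \<noteq> 1" if "l \<in> prime_factors n" for l
  proof -
    have "prime l" "l dvd n" using that by auto
    then have "0 < n div l" "n div l < n"
      using assms prime_gt_1_nat[of l] by (auto simp: div_greater_zero_iff dvd_imp_le)
    then show ?thesis using z by (auto simp: primitive_roots_of_unity_def)
  qed
  then show "z \<in> {z. z ^ n = 1} - (\<Union>l\<in>prime_factors n. {z. z ^ (n div l) = 1})"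
    using z by (auto simp: primitive_roots_of_unity_def)
next
  fix z
  assume z: "z \<in> {z::complex. z ^ n = 1} - (\<Union>l\<in>prime_factors n. {z. z ^ (n div l) = 1})"
  have "z ^ k \<noteq> 1" if k: "0 < k" "k < n" for k
  proof
    assume "z ^ k = 1"
    define d where "d = gcd k n"
    have d: "z ^ d = 1" "d dvd n"
      using \<open>z ^ k = 1\<close> z power_gcd_eq_one[of z k n] by (auto simp: d_def)
    have "d < n"
      using k by (simp add: d_def le_less_trans[OF gcd_le1_nat])
    then have "n div d \<noteq> 1"
      using d(2) by auto
    then obtain l where l: "prime l" "l dvd n div d"
      using prime_factor_nat by blast
    obtain e where "n div d = l * e" using l(2) by blast
    then have n: "n = l * (d * e)" using d(2) by (metis dvd_mult_div_cancel mult.left_commute)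
    then have "n div l = d * e" using l(1) by (simp add: prime_gt_0_nat)
    then have "z ^ (n div l) = 1" using d(1) by (simp add: power_mult)
    moreover have "l \<in> prime_factors n" using n l(1) assms by (auto simp: prime_factors_dvd)
    ultimately show False using z by auto
  qed
  then show "z \<in> primitive_roots_of_unity n"
    using z by (auto simp: primitive_roots_of_unity_def)
qed

text \<open>The derivative n x^(n-1) vanishes at most at 0, which is not a root, so x^n - 1 is
  squarefree and splits over its distinct roots.\<close>

lemma prod_roots_of_unity:
  assumes "n > 0"
  shows "(\<Prod>z | z ^ n = 1. [:- z, 1::complex:]) = monom 1 n - 1"
proof -
  let ?f = "monom 1 n - 1 :: complex poly"
  have lc: "lead_coeff ?f = 1"
  proof -
    have "degree ?f = n"
      using assms degree_add_eq_left[of "-1" "monom 1 n :: complex poly"]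
      by (simp add: degree_monom_eq)
    then show ?thesis using assms by simp
  qed
  have "rsquarefree ?f"
    using assms
    by (auto simp: rsquarefree_roots pderiv_diff pderiv_monom poly_monom power_0_left)
  then show ?thesis
    using complex_poly_decompose_rsquarefree[of ?f] lc by (simp add: poly_monom)
qed

text \<open>Inclusion-exclusion for the three sets of roots of order dividing pq, pr, qr, whose
  intersections are governed by gcds. The result is cross-multiplied so that no polynomial division
  occurs.\<close>

lemma cyclotomic_three_primes:
  assumes primes: "prime p" "prime q" "prime r" and ne: "p \<noteq> q" "p \<noteq> r" "q \<noteq> r"
  defines "U \<equiv> \<lambda>n. (monom 1 n - 1 :: complex poly)"
  shows "cyclotomic (p * q * r) * U (p * q) * U (p * r) * U (q * r) * U 1 =
         U (p * q * r) * U p * U q * U r"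
proof -
  have pos: "p > 0" "q > 0" "r > 0" using primes by (auto simp: prime_gt_0_nat)
  have cop: "coprime p q" "coprime p r" "coprime q r"
    using primes ne by (auto simp: primes_coprime)
  define V where "V = (\<lambda>n::nat. {z::complex. z ^ n = 1})"
  define P where "P = (\<lambda>A. \<Prod>z\<in>A. [:- z, 1::complex:])"
  have fin: "finite (V n)" if "n > 0" for n
    using that by (simp add: V_def finite_roots_unity)
  have PV: "P (V n) = U n" if "n > 0" for n
    using that by (simp add: P_def V_def U_def prod_roots_of_unity)
  have incl_excl: "P (A \<union> B) * P (A \<inter> B) = P A * P B" if "finite A" "finite B" for A B
    using that by (simp add: P_def prod.union_inter)
  have V_Int: "V a \<inter> V b = V (gcd a b)" for a b
    unfolding V_def by (rule roots_of_unity_Int)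
  have gcd1: "gcd p q = 1" "gcd p r = 1" "gcd q r = 1"
    using cop by (simp_all add: coprime_iff_gcd_eq_1)
  have "gcd (p * q) (p * r) = p" "gcd (q * p) (q * r) = q" "gcd (r * p) (r * q) = r"
    using gcd1 by (simp_all only: gcd_mult_distrib_nat[symmetric] mult_1_right)
  moreover have "gcd p (q * r) = 1"
    using cop by (simp only: coprime_iff_gcd_eq_1[symmetric] coprime_mult_right_iff)
  ultimately have g: "gcd (p * q) (p * r) = p" "gcd (p * q) (q * r) = q" "gcd (p * r) (q * r) = r"
      "gcd p (q * r) = 1"
    by (simp_all only: mult.commute)
  note g = g gcd1
  let ?A = "V (p * q)" and ?B = "V (p * r)" and ?C = "V (q * r)"
  have fins: "finite ?A" "finite ?B" "finite ?C" using pos by (auto intro: fin)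
  have Usub: "?A \<union> ?B \<union> ?C \<subseteq> V (p * q * r)"
    by (auto simp: V_def power_mult) (metis mult.commute mult.assoc power_mult power_one)+
  have pf: "prime_factors (p * q * r) = {p, q, r}"
    using primes by (auto simp: prime_factors_product prime_prime_factors pos)
  have prim: "primitive_roots_of_unity (p * q * r) = V (p * q * r) - (?A \<union> ?B \<union> ?C)"
  proof -
    have "p * q * r div p = q * r" "p * q * r div q = p * r" "p * q * r div r = p * q"
      using pos by (simp_all add: mult.commute mult.left_commute[of q])
    then show ?thesis
      using pos by (subst primitive_roots_of_unity_altdef) (auto simp only: pf V_def UN_insert UN_empty Un_empty_right Un_ac mult_pos_pos)
  qed
  have e1: "cyclotomic (p * q * r) * P (?A \<union> ?B \<union> ?C) = U (p * q * r)"
    using prod.subset_diff[OF Usub, of "\<lambda>z. [:- z, 1:]"] pos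
    by (simp add: cyclotomic_def prim P_def[symmetric] PV fin)
  \<comment> \<open>\<open>V q \<union> V r\<close> is the intersection of
    \<open>?A \<union> ?B\<close> with \<open>?C\<close>, so the triple union is handled by the
    two-set rule.\<close>
  have e2: "P (?A \<union> ?B \<union> ?C) * P (V q \<union> V r) = P (?A \<union> ?B) * U (q * r)"
    using incl_excl[of "?A \<union> ?B" ?C] fins pos by (simp add: Int_Un_distrib2 V_Int g PV)
  have e3: "P (?A \<union> ?B) * U p = U (p * q) * U (p * r)"
    using incl_excl[of ?A ?B] fins pos by (simp add: V_Int g PV)
  have e4: "P (V q \<union> V r) * U 1 = U q * U r"
    using incl_excl[of "V q" "V r"] pos by (simp add: V_Int g PV fin)
  have "cyclotomic (p * q * r) * U (p * q) * U (p * r) * U (q * r) * U 1 =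
        cyclotomic (p * q * r) * (P (?A \<union> ?B) * U (q * r)) * U p * U 1"
  proof -
    have "cyclotomic (p * q * r) * U (p * q) * U (p * r) * U (q * r) * U 1 =
          cyclotomic (p * q * r) * (U (p * q) * U (p * r)) * U (q * r) * U 1"
      by (simp only: mult_ac)
    then show ?thesis
      unfolding e3[symmetric] by (simp only: mult_ac)
  qed
  also have "\<dots> = (cyclotomic (p * q * r) * P (?A \<union> ?B \<union> ?C)) * (P (V q \<union> V r) * U 1) * U p"
    unfolding e2[symmetric] by (simp only: mult_ac)
  also have "\<dots> = U (p * q * r) * U p * U q * U r"
    unfolding e1 e4 by (simp only: mult_ac)
  finally show ?thesis .
qed

section \<open>The series of the cyclotomic polynomial of order 3p and of its reciprocal\<close>

text \<open>
  Throughout, the prime \<open>p\<close> is \<open>6 m + 1\<close>. \<open>phi_coeff m\<close> is the coefficient sequence of \<open>\<Phi>\<^bsub>3p\<^esub>\<close>, and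
  \<open>inv_coeff m\<close> that of the power series \<open>1 / \<Phi>\<^bsub>3p\<^esub> = (1 + x + x\<^sup>2) (1 - x\<^sup>p) / (1 - x\<^bsup>3p\<^esup>)\<close>, extended
  \<open>3p\<close>-periodically to the integers.
\<close>

definition phi_coeff :: "nat \<Rightarrow> nat \<Rightarrow> int" where
  "phi_coeff m j =
     (if j > 12 * m then 0
      else if j mod 3 = 0 then 1
      else if j mod 3 = 1 \<and> j < 6 * m + 1 then -1
      else if j mod 3 = 2 \<and> 6 * m + 1 \<le> j then -1 else 0)"

definition inv_coeff :: "nat \<Rightarrow> int \<Rightarrow> int" where
  "inv_coeff m i =
     (let s = i mod (18 * int m + 3)
      in of_bool (s \<in> {0, 1, 2}) - of_bool (s - (6 * int m + 1) \<in> {0, 1, 2}))"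

definition phi_fps :: "nat \<Rightarrow> complex fps" where
  "phi_fps m = Abs_fps (\<lambda>j. of_int (phi_coeff m j))"

definition inv_fps :: "nat \<Rightarrow> complex fps" where
  "inv_fps m = Abs_fps (\<lambda>i. of_int (inv_coeff m (int i)))"

lemma phi_coeff_mult_3:
  "phi_coeff m (3 * a) = of_bool (a \<le> 4 * m)"
  "phi_coeff m (3 * a + 1) = - of_bool (a < 2 * m)"
  "phi_coeff m (3 * a + 2) = - of_bool (2 * m \<le> a \<and> a < 4 * m)"
proof -
  have "(3 * a) mod 3 = 0" "(3 * a + 1) mod 3 = 1" "(3 * a + 2) mod 3 = 2" by presburger+
  then show "phi_coeff m (3 * a) = of_bool (a \<le> 4 * m)"
    "phi_coeff m (3 * a + 1) = - of_bool (a < 2 * m)"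
    "phi_coeff m (3 * a + 2) = - of_bool (2 * m \<le> a \<and> a < 4 * m)"
    by (simp_all only: phi_coeff_def of_bool_def) auto
qed

text \<open>Phi_{3p} is palindromic of degree 2(p - 1): the reflection exchanges the residues 1 and
  2 modulo 3 and, with them, the ranges below and above p.\<close>

lemma phi_coeff_sym:
  assumes "j \<le> 12 * m"
  shows "phi_coeff m (12 * m - j) = phi_coeff m j"
proof -
  define i where "i = 12 * m - j"
  have ij: "i + j = 12 * m" using assms by (simp add: i_def)
  then have dvd: "3 dvd i + j" by simp
  have "i mod 3 = 0 \<longleftrightarrow> j mod 3 = 0" "i mod 3 = 1 \<longleftrightarrow> j mod 3 = 2"
    "i mod 3 = 2 \<longleftrightarrow> j mod 3 = 1"
    using dvd by presburger+
  \<comment> \<open>The two ranges reflect onto each other except at the midpoint 6m, which has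
    residue 0 and so does no harm.\<close>
  moreover have "j \<noteq> 6 * m" if "j mod 3 \<noteq> 0" using that by auto
  moreover have "i < 6 * m + 1 \<longleftrightarrow> 6 * m \<le> j" "6 * m + 1 \<le> i \<longleftrightarrow> j < 6 * m" "i \<le> 12 * m"
    using ij by auto
  ultimately show ?thesis
    using assms unfolding phi_coeff_def i_def[symmetric] by simp linarith
qed

lemma inv_coeff_add_period: "inv_coeff m (i + k * (18 * int m + 3)) = inv_coeff m i"
  by (simp add: inv_coeff_def)

lemma inv_coeff_nat_less:
  assumes "0 < m" "i < 18 * m + 3"
  shows "inv_coeff m (int i) = of_bool (i < 3) - of_bool (6 * m + 1 \<le> i \<and> i < 6 * m + 4)"
proof -
  have "int i mod (18 * int m + 3) = int i"
    using assms by simp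
  moreover have "int i \<in> {0, 1, 2} \<longleftrightarrow> i < 3" by auto
  moreover have "int i - (6 * int m + 1) \<in> {0, 1, 2} \<longleftrightarrow> 6 * m + 1 \<le> i \<and> i < 6 * m + 4" by auto
  ultimately show ?thesis by (simp only: inv_coeff_def Let_def)
qed

text \<open>The reflection about p + 2 swaps the positive window {0, 1, 2} with the negative window
  {p, p + 1, p + 2}.\<close>

lemma inv_coeff_reflect:
  assumes "0 < m"
  shows "inv_coeff m (6 * int m + 3 - i) = - inv_coeff m i"
proof -
  have window: "i \<in> {0, 1, 2} \<longleftrightarrow> 0 \<le> i \<and> i \<le> 2" for i :: int by auto
  define M where "M = 18 * int m + 3"
  define s where "s = i mod M"
  have s: "0 \<le> s" "s < M" by (auto simp: s_def M_def)
  have "(6 * int m + 3 - i) mod M = (6 * int m + 3 - s) mod M"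
    by (simp add: s_def mod_diff_right_eq)
  also have "\<dots> = (if s \<le> 6 * int m + 3 then 6 * int m + 3 - s else 24 * int m + 6 - s)"
  proof (cases "s \<le> 6 * int m + 3")
    case True
    then show ?thesis using s assms by (subst mod_pos_pos_trivial) (auto simp: M_def)
  next
    case False
    then have "(6 * int m + 3 - s + M) mod M = 24 * int m + 6 - s"
      using s by (subst mod_pos_pos_trivial) (auto simp: M_def)
    then show ?thesis using False by simp
  qed
  finally have "(6 * int m + 3 - i) mod M =
    (if s \<le> 6 * int m + 3 then 6 * int m + 3 - s else 24 * int m + 6 - s)" .
  then show ?thesis
    using s assms unfolding inv_coeff_def M_def[symmetric] s_def[symmetric] Let_def
    unfolding window by (auto simp: M_def of_bool_def)
qed

lemma fps_compose_X_power_mult_nth: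
  fixes F G :: "'a :: comm_ring_1 fps"
  assumes "q > 0"
  shows "((F oo fps_X ^ q) * G) $ n = (\<Sum>j\<le>n div q. F $ j * G $ (n - q * j))"
proof -
  have "((F oo fps_X ^ q) * G) $ n =
        (\<Sum>i = 0..n. (if q dvd i then F $ (i div q) else 0) * G $ (n - i))"
    by (simp add: fps_mult_nth fps_nth_compose_X_power)
  also have "\<dots> = (\<Sum>i\<in>(\<lambda>j. q * j) ` {..n div q}. F $ (i div q) * G $ (n - i))"
  proof (rule sum.mono_neutral_cong_right)
    show "(\<lambda>j. q * j) ` {..n div q} \<subseteq> {0..n}"
      using assms by (auto simp: less_eq_div_iff_mult_less_eq mult.commute)
    show "\<forall>i\<in>{0..n} - (\<lambda>j. q * j) ` {..n div q}.
            (if q dvd i then F $ (i div q) else 0) * G $ (n - i) = 0"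
      using assms by (auto simp: image_iff less_eq_div_iff_mult_less_eq mult.commute elim!: dvdE)
  qed auto
  also have "\<dots> = (\<Sum>j\<le>n div q. F $ j * G $ (n - q * j))"
    using assms by (subst sum.reindex) (auto simp: inj_on_def)
  finally show ?thesis .
qed

text \<open>Coefficient form of Phi_{3p} (1 - x^3) = (1 - x)(1 + x^p + x^(2p)). Within one residue
  class modulo 3 the coefficients are constant between the thresholds 0, 2m and 4m, so differences
  survive only at the jumps.\<close>

lemma phi_coeff_diff:
  assumes "0 < m"
  defines "p \<equiv> 6 * m + 1"
  shows "phi_coeff m n - (if n < 3 then 0 else phi_coeff m (n - 3)) =
    of_bool (n = 0) - of_bool (n = 1) + of_bool (n = p) - of_bool (n = Suc p)
     + of_bool (n = 2 * p) - of_bool (n = Suc (2 * p))"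
proof (cases "n < 3")
  case True
  then consider "n = 3 * 0" | "n = 3 * 0 + 1" | "n = 3 * 0 + 2" by linarith
  then show ?thesis
    by cases (use assms in \<open>simp_all only: phi_coeff_mult_3, simp_all\<close>)
next
  case False
  define a where "a = n div 3 - 1"
  consider "n = 3 * Suc a" "n - 3 = 3 * a" | "n = 3 * Suc a + 1" "n - 3 = 3 * a + 1"
    | "n = 3 * Suc a + 2" "n - 3 = 3 * a + 2"
    using False unfolding a_def by fastforce
  then show ?thesis
  proof cases
    case 1
    have "n \<noteq> p" "n \<noteq> Suc p" "n \<noteq> 2 * p" "n = Suc (2 * p) \<longleftrightarrow> a = 4 * m"
      unfolding p_def 1 by presburger+
    moreover have "phi_coeff m n = of_bool (Suc a \<le> 4 * m)" "phi_coeff m (n - 3) = of_bool (a \<le> 4 * m)"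
      unfolding 1(2) unfolding 1(1) phi_coeff_mult_3 by (rule refl)+
    ultimately show ?thesis
      using False by auto
  next
    case 2
    have "n \<noteq> Suc p" "n \<noteq> 2 * p" "n \<noteq> Suc (2 * p)" "n = p \<longleftrightarrow> Suc a = 2 * m"
      unfolding p_def 2 by presburger+
    moreover have "phi_coeff m n = - of_bool (Suc a < 2 * m)" "phi_coeff m (n - 3) = - of_bool (a < 2 * m)"
      unfolding 2(2) unfolding 2(1) phi_coeff_mult_3 by (rule refl)+
    ultimately show ?thesis
      using False by auto
  next
    case 3
    have "n \<noteq> p" "n \<noteq> Suc (2 * p)" "n = Suc p \<longleftrightarrow> Suc a = 2 * m" "n = 2 * p \<longleftrightarrow> Suc a = 4 * m"
      unfolding p_def 3 by presburger+
    moreover have "phi_coeff m n = - of_bool (2 * m \<le> Suc a \<and> Suc a < 4 * m)"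
        "phi_coeff m (n - 3) = - of_bool (2 * m \<le> a \<and> a < 4 * m)"
      unfolding 3(2) unfolding 3(1) phi_coeff_mult_3 by (rule refl)+
    ultimately show ?thesis
      using False assms by auto
  qed
qed

text \<open>Multiplying the previous identity by 1 - x^p turns 1 + x^p + x^(2p) into 1 -
  x^(3p).\<close>

lemma phi_fps_eq:
  assumes "0 < m"
  shows "phi_fps m * ((1 - fps_X ^ 3) * (1 - fps_X ^ (6 * m + 1))) =
   (1 - fps_X) * (1 - fps_X ^ (18 * m + 3))"
proof -
  let ?p = "6 * m + 1"
  have "phi_fps m * (1 - fps_X ^ 3) =
        (1 - fps_X ^ 1) * (1 + fps_X ^ ?p + fps_X ^ (2 * ?p))" (is "?l = ?r")
  proof (rule fps_ext)
    fix n
    have "phi_coeff m n - (if n < 3 then 0 else phi_coeff m (n - 3)) =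
      of_bool (n = 0) - of_bool (n = 1) + of_bool (n = ?p) - of_bool (n = Suc ?p)
       + of_bool (n = 2 * ?p) - of_bool (n = Suc (2 * ?p))"
      using assms by (rule phi_coeff_diff)
    then have "(of_int (phi_coeff m n - (if n < 3 then 0 else phi_coeff m (n - 3))) :: complex) =
      of_int (of_bool (n = 0) - of_bool (n = 1) + of_bool (n = ?p) - of_bool (n = Suc ?p)
       + of_bool (n = 2 * ?p) - of_bool (n = Suc (2 * ?p)))"
      by (rule arg_cong)
    moreover have "?l $ n = of_int (phi_coeff m n - (if n < 3 then 0 else phi_coeff m (n - 3)))"
      by (simp add: phi_fps_def algebra_simps fps_X_power_mult_nth)
    moreover have "?r = 1 - fps_X ^ 1 + fps_X ^ ?p - fps_X ^ Suc ?p + fps_X ^ (2 * ?p) - fps_X ^ Suc (2 * ?p)"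
      by (simp add: algebra_simps)
    ultimately show "?l $ n = ?r $ n"
      by (simp only: fps_add_nth fps_sub_nth fps_X_power_nth fps_one_nth) (simp add: of_bool_def)
  qed
  moreover have "(1 + y + y ^ 2) * (1 - y) = 1 - y ^ 3" for y :: "complex fps"
    by (simp add: algebra_simps power2_eq_square power3_eq_cube)
  from this[of "fps_X ^ ?p"]
  have "(1 + fps_X ^ ?p + fps_X ^ (2 * ?p)) * (1 - fps_X ^ ?p) = (1 - fps_X ^ (18 * m + 3) :: complex fps)"
    by (simp only: power_mult[symmetric]) (simp add: algebra_simps)
  ultimately show ?thesis
    by (simp only: mult.assoc[symmetric]) (simp only: mult.assoc power_one_right)
qed

text \<open>Multiplication by 1 - x^(3p) cuts the periodic sequence down to its first period, the
  polynomial (1 + x + x^2)(1 - x^p).\<close>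

lemma inv_fps_eq:
  assumes "0 < m"
  shows "inv_fps m * ((1 - fps_X) * (1 - fps_X ^ (18 * m + 3))) =
   (1 - fps_X ^ 3) * (1 - fps_X ^ (6 * m + 1))"
proof -
  let ?p = "6 * m + 1" and ?M = "18 * m + 3"
  have "inv_fps m * (1 - fps_X ^ ?M) = (1 + fps_X ^ 1 + fps_X ^ 2) * (1 - fps_X ^ ?p)"
    (is "?l = ?r")
  proof (rule fps_ext)
    fix n
    have "inv_coeff m (int n) - (if n < ?M then 0 else inv_coeff m (int (n - ?M))) =
      of_bool (n = 0) + of_bool (n = 1) + of_bool (n = 2) - of_bool (n = ?p)
       - of_bool (n = ?p + 1) - of_bool (n = ?p + 2)"
    proof (cases "n < ?M")
      case True
      then show ?thesis using assms by (auto simp: inv_coeff_nat_less)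
    next
      case False
      have "inv_coeff m (int n) = inv_coeff m (int (n - ?M))"
        using False inv_coeff_add_period[of m "int (n - ?M)" 1] by (simp add: of_nat_diff)
      then show ?thesis using False assms by (simp del: of_nat_diff)
    qed
    then have "(of_int (inv_coeff m (int n) - (if n < ?M then 0 else inv_coeff m (int (n - ?M)))) :: complex) =
      of_int (of_bool (n = 0) + of_bool (n = 1) + of_bool (n = 2) - of_bool (n = ?p)
       - of_bool (n = ?p + 1) - of_bool (n = ?p + 2))"
      by (rule arg_cong)
    moreover have "?l $ n = of_int (inv_coeff m (int n) - (if n < ?M then 0 else inv_coeff m (int (n - ?M))))"
      by (simp add: inv_fps_def right_diff_distrib fps_X_power_mult_right_nth del: of_nat_diff)
    moreover have "?r = 1 + fps_X ^ 1 + fps_X ^ 2 - fps_X ^ ?p - fps_X ^ (?p + 1) - fps_X ^ (?p + 2)"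
      by (simp add: algebra_simps power_add[symmetric] power2_eq_square)
    ultimately show "?l $ n = ?r $ n"
      by (simp only: fps_add_nth fps_sub_nth fps_X_power_nth fps_one_nth) (simp add: of_bool_def)
  qed
  moreover have "(1 - fps_X) * (1 + fps_X ^ 1 + fps_X ^ 2) = (1 - fps_X ^ 3 :: complex fps)"
    by (simp add: algebra_simps power2_eq_square power3_eq_cube)
  moreover have "inv_fps m * ((1 - fps_X) * (1 - fps_X ^ ?M)) =
      (1 - fps_X) * (inv_fps m * (1 - fps_X ^ ?M))"
    by (simp only: ac_simps)
  ultimately show ?thesis
    by (simp only: mult.assoc[symmetric])
qed

text \<open>Used with f = x^q, x^2 and -x.\<close>

lemma phi_fps_compose:
  assumes "0 < m" and f: "f $ 0 = 0"
  shows "(phi_fps m oo f) * ((1 - f ^ 3) * (1 - f ^ (6 * m + 1))) = (1 - f) * (1 - f ^ (18 * m + 3))"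
  using arg_cong[OF phi_fps_eq[OF assms(1)], of "\<lambda>g. g oo f"] f
  by (simp only: fps_compose_mult_distrib fps_compose_sub_distrib fps_X_power_compose
      fps_compose_1 fps_X_fps_compose_startby0)

text \<open>Both series agree after multiplication by the common denominator \<open>D\<close>, which
  has constant term 1 and can be cancelled.\<close>

lemma coeff_cyclotomic:
  assumes "0 < m" and p: "p = 6 * m + 1" "prime p" and q: "prime q" "3 < q" "q \<noteq> p"
  shows "coeff (cyclotomic (3 * p * q)) n =
    of_int (\<Sum>j\<le>n div q. phi_coeff m j * inv_coeff m (int n - int q * int j))"
proof -
  let ?X = "fps_X :: complex fps"
  let ?F = "fps_of_poly (cyclotomic (3 * p * q))"
  let ?G = "(phi_fps m oo ?X ^ q) * inv_fps m"
  define D where "D = (1 - ?X ^ (3 * p)) * (1 - ?X ^ (3 * q)) * (1 - ?X ^ (p * q)) * (1 - ?X)"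
  have "3 \<noteq> p" "3 \<noteq> q" "prime (3::nat)" using assms by auto
  from cyclotomic_three_primes[OF this(3) p(2) q(1) this(1,2)] q
  have "fps_of_poly (cyclotomic (3 * p * q) * (monom 1 (3 * p) - 1) * (monom 1 (3 * q) - 1) *
          (monom 1 (p * q) - 1) * (monom 1 1 - 1)) =
        fps_of_poly ((monom 1 (3 * p * q) - 1) * (monom 1 3 - 1) * (monom 1 p - 1) * (monom 1 q - 1))"
    by (intro arg_cong[of _ _ fps_of_poly]) auto
  then have "?F * (((?X ^ (3 * p) - 1) * (?X ^ (3 * q) - 1)) * ((?X ^ (p * q) - 1) * (?X - 1))) =
        ((?X ^ (3 * p * q) - 1) * (?X ^ 3 - 1)) * ((?X ^ p - 1) * (?X ^ q - 1))"
    by (simp only: fps_of_poly_mult fps_of_poly_diff fps_of_poly_monom' fps_of_poly_1 mult.assoc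
        power_one_right)
  \<comment> \<open>Each side has four factors, so the signs disappear in pairs.\<close>
  moreover have "(x - 1) * (y - 1) = (1 - x) * (1 - y)" for x y :: "complex fps"
    by (simp add: algebra_simps)
  ultimately have F: "?F * D = (1 - ?X ^ (3 * p * q)) * (1 - ?X ^ 3) * (1 - ?X ^ p) * (1 - ?X ^ q)"
    by (simp only: D_def mult.assoc)
  have B: "(phi_fps m oo ?X ^ q) * ((1 - ?X ^ (3 * q)) * (1 - ?X ^ (p * q))) =
        (1 - ?X ^ q) * (1 - ?X ^ (3 * p * q))"
  proof -
    have "q * 3 = 3 * q" "q * (6 * m + 1) = p * q" "q * (18 * m + 3) = 3 * p * q"
      by (simp_all add: p(1) algebra_simps)
    then show ?thesis
      using phi_fps_compose[OF assms(1), of "?X ^ q"] q(2) by (simp only: power_mult[symmetric]) simp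
  qed
  have C: "inv_fps m * ((1 - ?X) * (1 - ?X ^ (3 * p))) = (1 - ?X ^ 3) * (1 - ?X ^ p)"
  proof -
    have "3 * p = 18 * m + 3" using p(1) by simp
    then show ?thesis using inv_fps_eq[OF assms(1)] by (simp only: p(1))
  qed
  have "?G * D = ((phi_fps m oo ?X ^ q) * ((1 - ?X ^ (3 * q)) * (1 - ?X ^ (p * q)))) *
        (inv_fps m * ((1 - ?X) * (1 - ?X ^ (3 * p))))"
    unfolding D_def by (simp only: ac_simps)
  then have "?G * D = ?F * D"
    unfolding B C F by (simp only: ac_simps)
  moreover have "D \<noteq> 0"
  proof -
    have "D $ 0 = 1" using p q by (simp add: D_def)
    then show ?thesis by auto
  qed
  ultimately have "?F = ?G" by simp
  then have "coeff (cyclotomic (3 * p * q)) n = ?G $ n"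
    by (metis fps_of_poly_nth)
  also have "\<dots> = (\<Sum>j\<le>n div q. of_int (phi_coeff m j) * of_int (inv_coeff m (int (n - q * j))))"
    using q by (simp add: fps_compose_X_power_mult_nth phi_fps_def inv_fps_def)
  also have "\<dots> = (\<Sum>j\<le>n div q. of_int (phi_coeff m j * inv_coeff m (int n - int q * int j)))"
    using q by (intro sum.cong)
      (auto simp: of_nat_diff less_eq_div_iff_mult_less_eq mult.commute)
  finally show ?thesis by simp
qed

text \<open>
  By the previous lemma and the periodicity of \<open>inv_coeff\<close>, if \<open>q \<equiv> 2\<close> modulo \<open>3p\<close> then the
  \<open>n\<close>-th coefficient of \<open>\<Phi>\<^bsub>3pq\<^esub>\<close> is \<open>partial_coeff m (n div q) n\<close>.
\<close>

definition partial_coeff :: "nat \<Rightarrow> nat \<Rightarrow> int \<Rightarrow> int" where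
  "partial_coeff m J s = (\<Sum>j\<le>J. phi_coeff m j * inv_coeff m (s - 2 * int j))"

section \<open>Periodicity, vanishing and symmetry of the partial sums\<close>

lemma partial_coeff_add_period: "partial_coeff m J (s + k * (18 * int m + 3)) = partial_coeff m J s"
  unfolding partial_coeff_def
proof (intro sum.cong refl)
  fix j
  have "s + k * (18 * int m + 3) - 2 * int j = (s - 2 * int j) + k * (18 * int m + 3)" by simp
  then show "phi_coeff m j * inv_coeff m (s + k * (18 * int m + 3) - 2 * int j) =
      phi_coeff m j * inv_coeff m (s - 2 * int j)"
    by (simp only: inv_coeff_add_period)
qed

text \<open>The case \<open>q = 2\<close>, where \<open>\<Phi>\<^bsub>3p\<^esub>(x\<^sup>2) / \<Phi>\<^bsub>3p\<^esub>(x) = \<Phi>\<^bsub>3p\<^esub>(- x)\<close>.\<close>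

lemma partial_coeff_half:
  assumes "0 < m"
  shows "partial_coeff m (n div 2) (int n) = (- 1) ^ n * phi_coeff m n"
proof -
  let ?X = "fps_X :: complex fps"
  let ?p = "6 * m + 1" and ?M = "18 * m + 3"
  let ?G = "(phi_fps m oo ?X ^ 2) * inv_fps m"
  let ?H = "phi_fps m oo (- ?X)"
  define D where "D = (1 - ?X ^ 6) * (1 - ?X ^ (2 * ?p)) * (1 - ?X) * (1 - ?X ^ ?M)"
  have B: "(phi_fps m oo ?X ^ 2) * ((1 - ?X ^ 6) * (1 - ?X ^ (2 * ?p))) =
        (1 - ?X ^ 2) * (1 - ?X ^ (2 * ?M))"
    using phi_fps_compose[OF assms, of "?X ^ 2"]
    by (simp only: power_mult[symmetric]) simp
  \<comment> \<open>The exponents 1, 3, p and 3p are odd, so substituting -x changes every minus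
    sign into a plus sign.\<close>
  have H: "?H * ((1 + ?X ^ 3) * (1 + ?X ^ ?p)) = (1 + ?X) * (1 + ?X ^ ?M)"
    using phi_fps_compose[OF assms, of "- ?X"] by (simp add: power_minus_odd)
  have sq: "1 - ?X ^ (2 * k) = (1 + ?X ^ k) * (1 - ?X ^ k)" for k
    by (simp add: algebra_simps power_add[symmetric] mult_2)
  have "?G * D = ((phi_fps m oo ?X ^ 2) * ((1 - ?X ^ 6) * (1 - ?X ^ (2 * ?p)))) *
        (inv_fps m * ((1 - ?X) * (1 - ?X ^ ?M)))"
    unfolding D_def by (simp only: ac_simps)
  also have "\<dots> = (1 - ?X ^ (2 * 1)) * (1 - ?X ^ (2 * ?M)) * ((1 - ?X ^ 3) * (1 - ?X ^ ?p))"
    unfolding B inv_fps_eq[OF assms] by simp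
  also have "\<dots> = ((1 + ?X) * (1 + ?X ^ ?M)) * ((1 - ?X ^ 3) * (1 - ?X ^ ?p) * ((1 - ?X) * (1 - ?X ^ ?M)))"
    unfolding sq power_one_right by (simp only: ac_simps)
  also have "\<dots> = ?H * (((1 + ?X ^ 3) * (1 - ?X ^ 3)) * ((1 + ?X ^ ?p) * (1 - ?X ^ ?p)) * (1 - ?X) * (1 - ?X ^ ?M))"
    unfolding H[symmetric] by (simp only: ac_simps)
  also have "\<dots> = ?H * D"
    unfolding D_def sq[symmetric] by simp
  finally have "?G * D = ?H * D" .
  moreover have "D \<noteq> 0"
  proof -
    have "D $ 0 = 1" by (simp add: D_def)
    then show ?thesis by auto
  qed
  ultimately have "?G = ?H" by simp
  then have "(\<Sum>j\<le>n div 2. of_int (phi_coeff m j) * of_int (inv_coeff m (int (n - 2 * j)))) =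
      ((- 1) ^ n * of_int (phi_coeff m n) :: complex)"
    using fps_compose_X_power_mult_nth[of 2 "phi_fps m" "inv_fps m" n]
    by (simp add: fps_compose_uminus' phi_fps_def inv_fps_def)
  also have "(\<Sum>j\<le>n div 2. of_int (phi_coeff m j) * of_int (inv_coeff m (int (n - 2 * j)))) =
      (of_int (partial_coeff m (n div 2) (int n)) :: complex)"
    unfolding partial_coeff_def of_int_sum of_int_mult by (intro sum.cong) (auto simp: of_nat_diff)
  finally have "of_int (partial_coeff m (n div 2) (int n)) =
      (of_int ((- 1) ^ n * phi_coeff m n) :: complex)" by simp
  then show ?thesis by (simp only: of_int_eq_iff)
qed

text \<open>Replacing s by a large representative n modulo 3p turns the full sum into a coefficient
  of Phi_{3p}(-x) beyond its degree.\<close>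

lemma partial_coeff_complete:
  assumes "0 < m" "12 * m \<le> J"
  shows "partial_coeff m J s = 0"
proof -
  have zero: "phi_coeff m j = 0" if "j > 12 * m" for j
    using that by (simp add: phi_coeff_def)
  \<comment> \<open>Adding 2J periods ensures n >= 2J, hence \<open>n div 2\<close> is at least J
    and n exceeds 12m.\<close>
  define n where "n = nat (s mod (18 * int m + 3)) + 2 * J * (18 * m + 3)"
  have n: "int n = s + (2 * int J - s div (18 * int m + 3)) * (18 * int m + 3)"
  proof -
    have "int (nat (s mod (18 * int m + 3))) = s - s div (18 * int m + 3) * (18 * int m + 3)"
      by (simp add: minus_div_mult_eq_mod)
    then show ?thesis by (simp add: n_def algebra_simps)
  qed
  have "2 * J * 1 \<le> 2 * J * (18 * m + 3)" by (intro mult_le_mono2) simp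
  then have "2 * J \<le> n" unfolding n_def by linarith
  then have J: "J \<le> n div 2" by linarith
  have "partial_coeff m J s = partial_coeff m J (int n)"
    unfolding n partial_coeff_add_period ..
  also have "\<dots> = partial_coeff m (n div 2) (int n)"
    unfolding partial_coeff_def using J assms(2) by (intro sum.mono_neutral_left) (auto simp: zero)
  also have "\<dots> = 0"
    using \<open>2 * J \<le> n\<close> assms zero[of n] by (simp add: partial_coeff_half)
  finally show ?thesis .
qed

text \<open>The complete sum vanishes, so the sum up to J is minus its tail; reversing the tail uses
  that \<open>phi_coeff\<close> is palindromic and \<open>inv_coeff\<close> antisymmetric. The
  constant 30m + 3 is 2 * 12m + (p + 2).\<close>

lemma partial_coeff_symmetry:
  assumes "0 < m" "J < 12 * m"
  shows "partial_coeff m (12 * m - 1 - J) (30 * int m + 3 - s) = partial_coeff m J s"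
proof -
  have "{..12 * m} = {..J} \<union> {J<..12 * m}" "{..J} \<inter> {J<..12 * m} = {}" using assms by auto
  then have "partial_coeff m (12 * m) s =
      partial_coeff m J s + (\<Sum>j\<in>{J<..12 * m}. phi_coeff m j * inv_coeff m (s - 2 * int j))"
    unfolding partial_coeff_def by (simp add: sum.union_disjoint)
  also have "(\<Sum>j\<in>{J<..12 * m}. phi_coeff m j * inv_coeff m (s - 2 * int j)) =
      (\<Sum>i\<le>12 * m - 1 - J. - (phi_coeff m i * inv_coeff m (30 * int m + 3 - s - 2 * int i)))"
  proof (rule sum.reindex_bij_witness[of _ "\<lambda>i. 12 * m - i" "\<lambda>j. 12 * m - j"])
    fix j assume j: "j \<in> {J<..12 * m}"
    have "30 * int m + 3 - s - 2 * int (12 * m - j) = 6 * int m + 3 - (s - 2 * int j)"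
      using j by (simp add: of_nat_diff)
    then show "- (phi_coeff m (12 * m - j) * inv_coeff m (30 * int m + 3 - s - 2 * int (12 * m - j))) =
        phi_coeff m j * inv_coeff m (s - 2 * int j)"
      using j by (simp only: inv_coeff_reflect[OF assms(1)] phi_coeff_sym greaterThanAtMost_iff)
  qed (use assms in auto)
  finally show ?thesis
    using partial_coeff_complete[OF assms(1), of "12 * m" s]
    by (simp add: partial_coeff_def sum_negf)
qed

section \<open>Counting over periodic sets of integers\<close>

definition cnt :: "(int \<Rightarrow> bool) \<Rightarrow> int \<Rightarrow> int \<Rightarrow> nat" where
  "cnt P a b = card ({a..<b} \<inter> {i. P i})"

lemma cnt_cong:
  assumes "\<And>i. a \<le> i \<Longrightarrow> i < b \<Longrightarrow> P i \<longleftrightarrow> Q i"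
  shows "cnt P a b = cnt Q a b"
  unfolding cnt_def by (rule arg_cong[of _ _ card]) (use assms in auto)

lemma cnt_eq_0:
  assumes "\<And>i. a \<le> i \<Longrightarrow> i < b \<Longrightarrow> \<not> P i"
  shows "cnt P a b = 0"
proof -
  have "{a..<b} \<inter> {i. P i} = {}" using assms by auto
  then show ?thesis by (simp only: cnt_def card.empty)
qed

lemma cnt_split:
  assumes "a \<le> b" "b \<le> c"
  shows "cnt P a c = cnt P a b + cnt P b c"
proof -
  have "{a..<c} \<inter> {i. P i} = ({a..<b} \<inter> {i. P i}) \<union> ({b..<c} \<inter> {i. P i})"
    using assms by auto
  then have "cnt P a c = card (({a..<b} \<inter> {i. P i}) \<union> ({b..<c} \<inter> {i. P i}))"
    by (simp only: cnt_def)
  also have "\<dots> = cnt P a b + cnt P b c"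
    unfolding cnt_def by (rule card_Un_disjoint) auto
  finally show ?thesis .
qed

lemma cnt_Suc: "a \<le> b \<Longrightarrow> cnt P a (b + 1) = cnt P a b + of_bool (P b)"
proof -
  assume "a \<le> b"
  have "{b..<b + 1} \<inter> {i. P i} = (if P b then {b} else {})" by auto
  then show ?thesis
    using cnt_split[OF \<open>a \<le> b\<close>, of "b + 1" P] by (simp add: cnt_def)
qed

lemma cnt_same [simp]: "cnt P a a = 0"
  by (simp add: cnt_def)

lemma cnt_shift: "cnt (\<lambda>i. P (i + d)) a b = cnt P (a + d) (b + d)"
  unfolding cnt_def
  by (rule bij_betw_same_card[of "\<lambda>i. i + d"])
     (rule bij_betw_byWitness[of _ "\<lambda>i. i - d"], auto)

text \<open>The \<open>+ 1\<close> at both ends restores a half-open interval after the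
  reversal.\<close>

lemma cnt_reflect: "cnt (\<lambda>i. P (d - i)) a b = cnt P (d - b + 1) (d - a + 1)"
  unfolding cnt_def
  by (rule bij_betw_same_card[of "\<lambda>i. d - i"])
     (rule bij_betw_byWitness[of _ "\<lambda>i. d - i"], auto)

text \<open>Sliding the window by one loses \<open>P a\<close> and gains the equal value
  \<open>P (a + M)\<close>. A negative start is first moved up by a multiple of M.\<close>

lemma cnt_period:
  assumes P: "\<And>i. P (i + M) = P i" and "0 < M"
  shows "cnt P a (a + M) = cnt P 0 M"
proof -
  have up: "cnt P (int n) (int n + M) = cnt P 0 M" for n
  proof (induction n)
    case (Suc n)
    have "cnt P (int n) (int n + M + 1) = cnt P (int n) (int n + 1) + cnt P (int n + 1) (int n + M + 1)"
      using \<open>0 < M\<close> by (intro cnt_split) auto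
    then have "cnt P (int n) (int n + M) = cnt P (int n + 1) (int n + M + 1)"
      using \<open>0 < M\<close> P[of "int n"] by (simp add: cnt_Suc)
    then show ?case using Suc by (simp add: algebra_simps)
  qed simp
  have P_mult: "P (i + int k * M) = P i" for i k
  proof (induction k)
    case (Suc k)
    then show ?case using P[of "i + int k * M"] by (simp add: algebra_simps)
  qed simp
  define k where "k = nat \<bar>a\<bar>"
  have "0 \<le> a + int k * M"
  proof -
    have "\<bar>a\<bar> * 1 \<le> \<bar>a\<bar> * M" using \<open>0 < M\<close> by (intro mult_left_mono) auto
    then show ?thesis by (simp add: k_def)
  qed
  then obtain n where n: "a + int k * M = int n"
    using nonneg_int_cases by blast
  have "cnt P a (a + M) = cnt (\<lambda>i. P (i + int k * M)) a (a + M)"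
    by (simp add: P_mult)
  also have "\<dots> = cnt P 0 M"
    using up[of n] by (simp only: cnt_shift n[symmetric]) (simp add: algebra_simps)
  finally show ?thesis .
qed

lemma cnt_periods:
  assumes "\<And>i. P (i + M) = P i" "0 < M"
  shows "cnt P a (a + int k * M) = k * cnt P 0 M"
proof (induction k)
  case (Suc k)
  have "cnt P a (a + int k * M + M) = cnt P a (a + int k * M) + cnt P (a + int k * M) (a + int k * M + M)"
    using \<open>0 < M\<close> by (intro cnt_split) auto
  then show ?case
    using Suc cnt_period[of P M "a + int k * M", OF assms] by (simp add: algebra_simps)
qed simp

section \<open>Nonzero partial coefficients in one period\<close>

text \<open>
  \<open>pat\<close> is the coefficient sequence of \<open>(1 + x - x\<^sup>3 - x\<^sup>4) / (1 - x\<^sup>6)\<close>, where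
  \<open>1 + x - x\<^sup>3 - x\<^sup>4 = (1 + x + x\<^sup>2) (1 - x\<^sup>2)\<close> is the contribution of \<open>phi_coeff m (3 i) = 1\<close> and
  \<open>phi_coeff m (3 i + 1) = -1\<close> in the range below \<open>p\<close>.
\<close>

definition pat :: "int \<Rightarrow> int" where
  "pat s = (if s mod 6 = 0 \<or> s mod 6 = 1 then 1 else if s mod 6 = 3 \<or> s mod 6 = 4 then -1 else 0)"

lemma pat_add_6: "pat (s + 6) = pat s"
  by (simp add: pat_def)

lemma pat_mult_6: "pat (6 * k + s) = pat s" "pat (6 * k) = 1"
  by (simp_all add: pat_def)

lemma pat_values:
  "pat 0 = 1" "pat 1 = 1" "pat 2 = 0" "pat 3 = - 1" "pat 4 = - 1" "pat 5 = 0" "pat (- 1) = 0"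
  by (simp_all add: pat_def)

lemma atLeastLessThan_0_6: "{0..<6::int} = {0, 1, 2, 3, 4, 5}"
  by auto

lemma cnt_pat: "cnt (\<lambda>s. pat s \<noteq> 0) a (a + 6 * int k) = 4 * k"
proof -
  have "{0..<6} \<inter> {s. pat s \<noteq> 0} = {0, 1, 3, 4}"
    unfolding atLeastLessThan_0_6 by (simp add: pat_values Int_insert_left)
  then have "cnt (\<lambda>s. pat s \<noteq> 0) 0 6 = 4" by (simp add: cnt_def)
  then show ?thesis
    using cnt_periods[of "\<lambda>s. pat s \<noteq> 0" 6 a k] by (simp add: pat_add_6 mult.commute)
qed

text \<open>Comparing with the shift by one covers the shift by p = 6m + 1, where the pattern
  overlaps its own copy.\<close>

lemma cnt_pat_diff: "cnt (\<lambda>s. pat s \<noteq> pat (s - 1)) a (a + 6 * int k) = 4 * k"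
proof -
  have "{0..<6} \<inter> {s. pat s \<noteq> pat (s - 1)} = {0, 2, 3, 5}"
    unfolding atLeastLessThan_0_6 by (simp add: pat_values Int_insert_left)
  then have *: "cnt (\<lambda>s. pat s \<noteq> pat (s - 1)) 0 6 = 4" by (simp add: cnt_def)
  have "pat (s + 6 - 1) = pat (s - 1)" for s
    using pat_add_6[of "s - 1"] by (simp add: algebra_simps)
  then show ?thesis
    using * cnt_periods[of "\<lambda>s. pat s \<noteq> pat (s - 1)" 6 a k] by (simp add: pat_add_6 mult.commute)
qed

text \<open>The coefficients of (1 + x + x^2) times the truncation of Phi_{3p}(x^2) after its J-th
  coefficient; the factor 1 - x^p is left out, to be restored by subtracting a copy shifted by
  p.\<close>

definition wave :: "nat \<Rightarrow> nat \<Rightarrow> int \<Rightarrow> int" where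
  "wave m J s = (\<Sum>j\<le>J. phi_coeff m j * of_bool (2 * int j \<le> s \<and> s \<le> 2 * int j + 2))"

text \<open>
  For \<open>J < p - 1\<close> no wrap-around modulo \<open>3p\<close> occurs. The other half of the range is reached by
  \<open>partial_coeff_symmetry\<close>.
\<close>

lemma partial_coeff_wave:
  assumes "J < 6 * m" "0 \<le> s" "s < 18 * int m + 3"
  shows "partial_coeff m J s = wave m J s - wave m J (s - (6 * int m + 1))"
proof -
  have "inv_coeff m (s - 2 * int j) = of_bool (2 * int j \<le> s \<and> s \<le> 2 * int j + 2) -
      of_bool (2 * int j \<le> s - (6 * int m + 1) \<and> s - (6 * int m + 1) \<le> 2 * int j + 2)"
    if "j \<le> J" for j
  proof -
    define t where "t = s - 2 * int j"
    \<comment> \<open>A negative t exceeds -12m, so its residue t + 3p lies above p + 2 = 6m + 3 and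
      misses both windows of \<open>inv_coeff\<close>.\<close>
    have t: "- 12 * int m < t" "t < 18 * int m + 3" using that assms by (auto simp: t_def)
    have "t mod (18 * int m + 3) = (if 0 \<le> t then t else t + (18 * int m + 3))"
    proof (cases "0 \<le> t")
      case False
      then have "(t + (18 * int m + 3)) mod (18 * int m + 3) = t + (18 * int m + 3)"
        using t by (intro mod_pos_pos_trivial) auto
      then show ?thesis using False by simp
    qed (use t in simp)
    moreover have window: "i \<in> {0, 1, 2} \<longleftrightarrow> 0 \<le> i \<and> i \<le> 2" for i :: int by auto
    ultimately show ?thesis
      using t unfolding inv_coeff_def t_def[symmetric] Let_def window
      by (auto simp: t_def of_bool_def)
  qed
  then show ?thesis
    unfolding partial_coeff_def wave_def sum_subtractf[symmetric]
    by (intro sum.cong) (simp_all add: right_diff_distrib)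
qed

section \<open>Closed forms of the waves\<close>

lemma wave_Suc: "wave m (Suc J) s =
    wave m J s + phi_coeff m (Suc J) * of_bool (2 * int J + 2 \<le> s \<and> s \<le> 2 * int J + 4)"
  by (simp add: wave_def algebra_simps)

text \<open>Each triple of coefficients 1, -1, 0 appends exactly one period 1, 1, 0, -1, -1, 0 of
  \<open>pat\<close>: its two windows of length three overlap in one cancelling position.\<close>

lemma wave_mod_2:
  assumes "I < 2 * m"
  shows "wave m (3 * I + 2) s = (if 0 \<le> s \<and> s < 6 * int I + 6 then pat s else 0)"
  using assms
proof (induction I)
  case 0
  have "phi_coeff m 0 = 1" "phi_coeff m 1 = - 1" "phi_coeff m 2 = 0"
    using phi_coeff_mult_3[of m 0] 0 by (simp_all add: numeral_2_eq_2)
  then have "wave m 2 s = of_bool (0 \<le> s \<and> s \<le> 2) - of_bool (2 \<le> s \<and> s \<le> 4)"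
    using wave_Suc[of m 0 s] wave_Suc[of m 1 s] by (simp add: wave_def numeral_2_eq_2)
  moreover have "s = 0 \<or> s = 1 \<or> s = 2 \<or> s = 3 \<or> s = 4 \<or> s = 5" if "0 \<le> s" "s < 6"
    using that by auto
  ultimately show ?case by (auto simp: pat_def numeral_2_eq_2)
next
  case (Suc I)
  have c: "phi_coeff m (3 * I + 3) = 1" "phi_coeff m (3 * I + 4) = - 1" "phi_coeff m (3 * I + 5) = 0"
    using phi_coeff_mult_3[of m "Suc I"] Suc.prems by (simp_all add: algebra_simps)
  have "wave m (3 * Suc I + 2) s = wave m (3 * I + 2) s +
     of_bool (6 * int I + 6 \<le> s \<and> s \<le> 6 * int I + 8) - of_bool (6 * int I + 8 \<le> s \<and> s \<le> 6 * int I + 10)"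
    using wave_Suc[of m "3 * I + 2" s] wave_Suc[of m "3 * I + 3" s] wave_Suc[of m "3 * I + 4" s] c
    by (simp add: eval_nat_numeral algebra_simps)
  moreover have "pat s = of_bool (s \<le> 6 * int I + 8) - of_bool (6 * int I + 8 \<le> s \<and> s \<le> 6 * int I + 10)"
    if "6 * int I + 6 \<le> s" "s < 6 * int I + 12"
  proof -
    define t where "t = s - (6 * int I + 6)"
    have "pat s = pat t"
      using pat_mult_6(1)[of "int I + 1" t] by (simp add: t_def algebra_simps)
    moreover have "t = 0 \<or> t = 1 \<or> t = 2 \<or> t = 3 \<or> t = 4 \<or> t = 5"
      using that unfolding t_def by presburger
    moreover have "s = 6 * int I + 6 + t" by (simp add: t_def)
    ultimately show ?thesis by (auto simp: pat_def)
  qed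
  ultimately show ?case
    using Suc by auto
qed

lemma wave_mod_1:
  assumes "I < 2 * m"
  shows "wave m (3 * I + 1) s = (if 0 \<le> s \<and> s < 6 * int I + 6 then pat s else 0)"
  using wave_mod_2[OF assms, of s] wave_Suc[of m "3 * I + 1" s] phi_coeff_mult_3(3)[of m I] assms
  by simp

text \<open>The last triple has not yet received its negative window. Its positive window therefore
  sticks out with a 1 at 6I + 2, where \<open>pat\<close> is 0.\<close>

lemma wave_mod_0:
  assumes "I < 2 * m"
  shows "wave m (3 * I) s =
    (if 0 \<le> s \<and> s < 6 * int I + 2 then pat s else of_bool (s = 6 * int I + 2))"
proof -
  have "wave m (3 * I) s = (if 0 \<le> s \<and> s < 6 * int I + 6 then pat s else 0) +
      of_bool (6 * int I + 2 \<le> s \<and> s \<le> 6 * int I + 4)"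
    using wave_mod_1[OF assms, of s] wave_Suc[of m "3 * I" s] phi_coeff_mult_3(2)[of m I] assms
    by simp
  moreover have "pat s = of_bool (s = 6 * int I + 2) - of_bool (s \<le> 6 * int I + 4)"
    if "6 * int I + 2 \<le> s" "s < 6 * int I + 6"
  proof -
    define t where "t = s - 6 * int I"
    have "s = 6 * int I + t" by (simp add: t_def)
    moreover have "t = 2 \<or> t = 3 \<or> t = 4 \<or> t = 5"
      using that unfolding t_def by presburger
    ultimately show ?thesis by (auto simp: pat_mult_6) (auto simp: pat_def)
  qed
  ultimately show ?thesis by auto
qed

section \<open>Nonzero values of one block in one period\<close>

definition weight :: "nat \<Rightarrow> nat \<Rightarrow> nat" where
  "weight m J = cnt (\<lambda>s. partial_coeff m J s \<noteq> 0) 0 (18 * int m + 3)"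

lemma weight_wave:
  assumes "J < 6 * m"
  shows "weight m J = cnt (\<lambda>s. wave m J s \<noteq> wave m J (s - (6 * int m + 1))) 0 (18 * int m + 3)"
  unfolding weight_def by (rule cnt_cong) (simp add: partial_coeff_wave[OF assms])

lemma cnt_shift_diff: "cnt (\<lambda>s. P (s - d)) a b = cnt P (a - d) (b - d)"
  using cnt_shift[of P "- d" a b] by simp

text \<open>The wave is supported in [0, L) with L <= p, so it does not meet its copy in [p, p + L)
  and nothing cancels.\<close>

lemma weight_disjoint:
  assumes "J < 6 * m" "0 \<le> L" "L \<le> 6 * int m + 1"
    and wave_0: "\<And>s. s < 0 \<or> L \<le> s \<Longrightarrow> wave m J s = 0"
  shows "weight m J = 2 * cnt (\<lambda>s. wave m J s \<noteq> 0) 0 L"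
proof -
  let ?p = "6 * int m + 1"
  let ?P = "\<lambda>s. wave m J s \<noteq> wave m J (s - ?p)"
  have "cnt ?P 0 (18 * int m + 3) =
      cnt ?P 0 L + (cnt ?P L ?p + (cnt ?P ?p (?p + L) + cnt ?P (?p + L) (18 * int m + 3)))"
    using assms(2,3) by (subst cnt_split[of 0 L], simp, simp, subst cnt_split[of L ?p], simp, simp,
      subst cnt_split[of ?p "?p + L"]) simp_all
  also have "cnt ?P 0 L = cnt (\<lambda>s. wave m J s \<noteq> 0) 0 L"
    using assms(3) by (intro cnt_cong) (simp add: wave_0)
  also have "cnt ?P L ?p = 0"
    by (intro cnt_eq_0) (simp add: wave_0)
  also have "cnt ?P ?p (?p + L) = cnt (\<lambda>s. wave m J (s - ?p) \<noteq> 0) ?p (?p + L)"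
    using assms(3) by (intro cnt_cong) (auto simp: wave_0)
  also have "\<dots> = cnt (\<lambda>s. wave m J s \<noteq> 0) 0 L"
    by (simp add: cnt_shift_diff[of "\<lambda>s. wave m J s \<noteq> 0"])
  also have "cnt ?P (?p + L) (18 * int m + 3) = 0"
    using assms(2) by (intro cnt_eq_0) (simp add: wave_0)
  finally show ?thesis
    using weight_wave[OF assms(1)] by simp
qed

text \<open>The wave stands alone on [0, p), meets its copy on [p, L), and leaves the copy alone on
  [L, p + L), which is counted after shifting back by p. The bound L <= 2p keeps everything inside
  one period.\<close>

lemma weight_overlap:
  assumes "J < 6 * m" "6 * int m + 1 \<le> L" "L \<le> 12 * int m + 2"
    and wave_0: "\<And>s. s < 0 \<or> L \<le> s \<Longrightarrow> wave m J s = 0"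
  shows "weight m J = cnt (\<lambda>s. wave m J s \<noteq> 0) 0 (6 * int m + 1) +
    cnt (\<lambda>s. wave m J s \<noteq> wave m J (s - (6 * int m + 1))) (6 * int m + 1) L +
    cnt (\<lambda>s. wave m J s \<noteq> 0) (L - (6 * int m + 1)) L"
proof -
  let ?p = "6 * int m + 1"
  let ?P = "\<lambda>s. wave m J s \<noteq> wave m J (s - ?p)"
  have "cnt ?P 0 (18 * int m + 3) =
      cnt ?P 0 ?p + (cnt ?P ?p L + (cnt ?P L (?p + L) + cnt ?P (?p + L) (18 * int m + 3)))"
    using assms(2,3) by (subst cnt_split[of 0 ?p], simp, simp, subst cnt_split[of ?p L], simp, simp,
      subst cnt_split[of L "?p + L"]) simp_all
  also have "cnt ?P 0 ?p = cnt (\<lambda>s. wave m J s \<noteq> 0) 0 ?p"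
    by (intro cnt_cong) (simp add: wave_0)
  also have "cnt ?P L (?p + L) = cnt (\<lambda>s. wave m J (s - ?p) \<noteq> 0) L (?p + L)"
    by (intro cnt_cong) (auto simp: wave_0)
  also have "\<dots> = cnt (\<lambda>s. wave m J s \<noteq> 0) (L - ?p) L"
    by (simp add: cnt_shift_diff[of "\<lambda>s. wave m J s \<noteq> 0"])
  also have "cnt ?P (?p + L) (18 * int m + 3) = 0"
    using assms(2) by (intro cnt_eq_0) (simp add: wave_0)
  finally show ?thesis
    using weight_wave[OF assms(1)] by simp
qed

lemma weight_same: "I < 2 * m \<Longrightarrow> weight m (3 * I + 2) = weight m (3 * I + 1)"
proof -
  assume I: "I < 2 * m"
  then have less: "3 * I + 1 < 6 * m" "3 * I + 2 < 6 * m" by auto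
  have "wave m (3 * I + 2) = wave m (3 * I + 1)"
    by (rule ext) (simp only: wave_mod_1[OF I] wave_mod_2[OF I])
  then show ?thesis
    by (simp only: less[THEN weight_wave])
qed

lemma weight_mod_1_less:
  assumes "I < m"
  shows "weight m (3 * I + 1) = 8 * I + 8"
proof -
  have I: "I < 2 * m" using assms by simp
  have "weight m (3 * I + 1) = 2 * cnt (\<lambda>s. wave m (3 * I + 1) s \<noteq> 0) 0 (6 * int I + 6)"
    using assms by (intro weight_disjoint) (auto simp: wave_mod_1[OF I] simp del: One_nat_def)
  also have "cnt (\<lambda>s. wave m (3 * I + 1) s \<noteq> 0) 0 (6 * int I + 6) =
      cnt (\<lambda>s. pat s \<noteq> 0) 0 (6 * int I + 6)"
    by (intro cnt_cong) (simp only: wave_mod_1[OF I], simp)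
  also have "\<dots> = 4 * (I + 1)"
    using cnt_pat[of 0 "I + 1"] by (simp add: algebra_simps)
  finally show ?thesis by simp
qed

text \<open>The wave has I full periods with 4 nonzero values each, two more at 6I and 6I + 1, and
  the overhang at 6I + 2; the copy doubles 4I + 3.\<close>

lemma weight_mod_0_less:
  assumes "I < m"
  shows "weight m (3 * I) = 8 * I + 6"
proof -
  have I: "I < 2 * m" using assms by simp
  have "weight m (3 * I) = 2 * cnt (\<lambda>s. wave m (3 * I) s \<noteq> 0) 0 (6 * int I + 3)"
    using assms by (intro weight_disjoint) (auto simp: wave_mod_0[OF I])
  also have "cnt (\<lambda>s. wave m (3 * I) s \<noteq> 0) 0 (6 * int I + 3) =
      cnt (\<lambda>s. wave m (3 * I) s \<noteq> 0) 0 (6 * int I + 2) + 1"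
  proof -
    have "wave m (3 * I) (6 * int I + 2) = 1"
      by (simp add: wave_mod_0[OF I])
    then show ?thesis
      using cnt_Suc[of 0 "6 * int I + 2" "\<lambda>s. wave m (3 * I) s \<noteq> 0"]
      by (simp add: add.commute)
  qed
  also have "cnt (\<lambda>s. wave m (3 * I) s \<noteq> 0) 0 (6 * int I + 2) =
      cnt (\<lambda>s. pat s \<noteq> 0) 0 (6 * int I + 2)"
    by (intro cnt_cong) (simp only: wave_mod_0[OF I], simp)
  also have "\<dots> = cnt (\<lambda>s. pat s \<noteq> 0) 0 (6 * int I) + 2"
  proof -
    have "pat (6 * int I + 1) = 1"
      by (simp add: pat_mult_6 pat_values)
    then show ?thesis
      using cnt_Suc[of 0 "6 * int I" "\<lambda>s. pat s \<noteq> 0"]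
        cnt_Suc[of 0 "6 * int I + 1" "\<lambda>s. pat s \<noteq> 0"]
      by (simp add: pat_mult_6 add.commute)
  qed
  also have "cnt (\<lambda>s. pat s \<noteq> 0) 0 (6 * int I) = 4 * I"
    using cnt_pat[of 0 I] by simp
  finally show ?thesis by simp
qed

lemma pat_shift_diff: "pat (s - (6 * int m + 1)) = pat (s - 1)"
  using pat_mult_6(1)[of "int m" "s - (6 * int m + 1)"] by simp

lemma cnt_pat_first: "cnt (\<lambda>s. pat s \<noteq> 0) 0 (6 * int m + 1) = 4 * m + 1"
  using cnt_pat[of 0 m] by (simp add: cnt_Suc pat_mult_6)

text \<open>With I = m + k the three regions contribute 4m + 1, 4k + 3 and 4m.\<close>

lemma weight_mod_1_ge:
  assumes "m \<le> I" "I < 2 * m"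
  shows "weight m (3 * I + 1) = 4 * I + 4 * m + 4"
proof -
  let ?W = "wave m (3 * I + 1)" and ?p = "6 * int m + 1" and ?L = "6 * int I + 6"
  note W = wave_mod_1[OF assms(2)]
  obtain k where k: "I = m + k" using assms(1) le_Suc_ex by blast
  have "weight m (3 * I + 1) = cnt (\<lambda>s. ?W s \<noteq> 0) 0 ?p + cnt (\<lambda>s. ?W s \<noteq> ?W (s - ?p)) ?p ?L +
      cnt (\<lambda>s. ?W s \<noteq> 0) (?L - ?p) ?L"
    using assms by (intro weight_overlap) (simp_all only: W, auto)
  also have "cnt (\<lambda>s. ?W s \<noteq> 0) 0 ?p = cnt (\<lambda>s. pat s \<noteq> 0) 0 ?p"
    using assms by (intro cnt_cong) (simp only: W, simp)
  also have "cnt (\<lambda>s. ?W s \<noteq> ?W (s - ?p)) ?p ?L = cnt (\<lambda>s. pat s \<noteq> pat (s - 1)) ?p ?L"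
    using assms by (intro cnt_cong) (simp only: W pat_shift_diff, simp)
  \<comment> \<open>The overlap is one position short of k + 1 periods; the missing position
    \<open>?L\<close> is a jump of \<open>pat\<close> from 0 to 1.\<close>
  also have "\<dots> = 4 * k + 3"
  proof -
    have "cnt (\<lambda>s. pat s \<noteq> pat (s - 1)) ?p (?L + 1) = 4 * (k + 1)"
      using cnt_pat_diff[of ?p "k + 1"] by (simp add: k algebra_simps)
    moreover have "cnt (\<lambda>s. pat s \<noteq> pat (s - 1)) ?p (?L + 1) =
        cnt (\<lambda>s. pat s \<noteq> pat (s - 1)) ?p ?L + of_bool (pat ?L \<noteq> pat (?L - 1))"
      using assms by (intro cnt_Suc) simp
    moreover have "pat ?L = 1" "pat (?L - 1) = 0"
      using pat_mult_6(1)[of "int I + 1" 0] pat_mult_6(1)[of "int I" 5]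
      by (simp_all add: pat_values add.commute)
    ultimately show ?thesis by (simp add: add.commute)
  qed
  also have "cnt (\<lambda>s. ?W s \<noteq> 0) (?L - ?p) ?L = cnt (\<lambda>s. pat s \<noteq> 0) (?L - ?p) ?L"
    using assms by (intro cnt_cong) (simp only: W, simp)
  \<comment> \<open>This region has length 6m + 1; its last position carries the value 0, and m full
    periods remain.\<close>
  also have "\<dots> = 4 * m"
  proof -
    have "cnt (\<lambda>s. pat s \<noteq> 0) (?L - ?p) (?L - 1 + 1) =
        cnt (\<lambda>s. pat s \<noteq> 0) (?L - ?p) (?L - 1) + of_bool (pat (?L - 1) \<noteq> 0)"
      by (intro cnt_Suc) simp
    moreover have "cnt (\<lambda>s. pat s \<noteq> 0) (?L - ?p) (?L - 1) = 4 * m"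
      using cnt_pat[of "?L - ?p" m] by (simp add: algebra_simps)
    moreover have "pat (?L - 1) = 0"
      using pat_mult_6(1)[of "int I" 5] by (simp add: pat_values add.commute)
    ultimately show ?thesis by (simp add: add.commute)
  qed
  finally show ?thesis by (simp add: cnt_pat_first k)
qed

text \<open>With I = m + k the three regions contribute 4m + 1, 4k and 4m + 1. Here the support is
  [0, \<open>?L + 1\<close>), with the overhang at \<open>?L\<close> split off each time.\<close>

lemma weight_mod_0_ge:
  assumes "m \<le> I" "I < 2 * m"
  shows "weight m (3 * I) = 4 * I + 4 * m + 2"
proof -
  let ?W = "wave m (3 * I)" and ?p = "6 * int m + 1" and ?L = "6 * int I + 2"
  note W = wave_mod_0[OF assms(2)]
  obtain k where k: "I = m + k" using assms(1) le_Suc_ex by blast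
  have "weight m (3 * I) = cnt (\<lambda>s. ?W s \<noteq> 0) 0 ?p + cnt (\<lambda>s. ?W s \<noteq> ?W (s - ?p)) ?p (?L + 1) +
      cnt (\<lambda>s. ?W s \<noteq> 0) (?L + 1 - ?p) (?L + 1)"
    using assms by (intro weight_overlap) (simp_all only: W, auto)
  also have "cnt (\<lambda>s. ?W s \<noteq> 0) 0 ?p = cnt (\<lambda>s. pat s \<noteq> 0) 0 ?p"
    using assms by (intro cnt_cong) (simp only: W, simp)
  also have "cnt (\<lambda>s. ?W s \<noteq> ?W (s - ?p)) ?p (?L + 1) =
      cnt (\<lambda>s. ?W s \<noteq> ?W (s - ?p)) ?p ?L + of_bool (?W ?L \<noteq> ?W (?L - ?p))"
    using assms by (intro cnt_Suc) simp
  also have "?W ?L = 1" by (simp only: W, simp)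
  \<comment> \<open>The overhang meets an equal value of the shifted copy and cancels.\<close>
  also have "?W (?L - ?p) = 1"
  proof -
    have "pat (?L - ?p) = 1"
      using pat_shift_diff[of ?L m] pat_mult_6(1)[of "int I" 1] by (simp add: pat_values add.commute)
    then show ?thesis using assms by (simp only: W, simp)
  qed
  also have "cnt (\<lambda>s. ?W s \<noteq> ?W (s - ?p)) ?p ?L = cnt (\<lambda>s. pat s \<noteq> pat (s - 1)) ?p ?L"
    using assms by (intro cnt_cong) (simp only: W pat_shift_diff, simp)
  \<comment> \<open>The extra position beyond k periods is \<open>?L - 1\<close> = 6I + 1, where
    \<open>pat\<close> does not change.\<close>
  also have "\<dots> = 4 * k"
  proof -
    have "cnt (\<lambda>s. pat s \<noteq> pat (s - 1)) ?p (?L - 1 + 1) =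
        cnt (\<lambda>s. pat s \<noteq> pat (s - 1)) ?p (?L - 1) + of_bool (pat (?L - 1) \<noteq> pat (?L - 1 - 1))"
      using assms by (intro cnt_Suc) simp
    moreover have "cnt (\<lambda>s. pat s \<noteq> pat (s - 1)) ?p (?L - 1) = 4 * k"
      using cnt_pat_diff[of ?p k] by (simp add: k algebra_simps)
    moreover have "pat (?L - 1) = 1" "pat (?L - 1 - 1) = 1"
      using pat_mult_6(1)[of "int I" 1] pat_mult_6(2)[of "int I"] by (simp_all add: pat_values add.commute)
    ultimately show ?thesis by (simp add: add.commute)
  qed
  also have "cnt (\<lambda>s. ?W s \<noteq> 0) (?L + 1 - ?p) (?L + 1) =
      cnt (\<lambda>s. ?W s \<noteq> 0) (?L + 1 - ?p) ?L + of_bool (?W ?L \<noteq> 0)"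
    by (intro cnt_Suc) simp
  also have "?W ?L = 1" by (simp only: W, simp)
  also have "cnt (\<lambda>s. ?W s \<noteq> 0) (?L + 1 - ?p) ?L = cnt (\<lambda>s. pat s \<noteq> 0) (?L + 1 - ?p) ?L"
    using assms by (intro cnt_cong) (simp only: W, simp)
  also have "\<dots> = 4 * m"
    using cnt_pat[of "?L + 1 - ?p" m] by (simp add: algebra_simps)
  finally show ?thesis by (simp add: cnt_pat_first k)
qed

text \<open>The symmetry reflects the positions, so one period is carried to another window of the
  same length, starting at 30m + 3 - 3p + 1 = 12m + 1.\<close>

lemma weight_symmetry:
  assumes "0 < m" "J < 12 * m"
  shows "weight m (12 * m - 1 - J) = weight m J"
proof -
  let ?M = "18 * int m + 3"
  have per: "partial_coeff m J (s + ?M) = partial_coeff m J s" for J s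
    using partial_coeff_add_period[of m J s 1] by simp
  have "weight m J = cnt (\<lambda>s. partial_coeff m (12 * m - 1 - J) (30 * int m + 3 - s) \<noteq> 0) 0 ?M"
    unfolding weight_def by (simp only: partial_coeff_symmetry[OF assms])
  also have "\<dots> = cnt (\<lambda>s. partial_coeff m (12 * m - 1 - J) s \<noteq> 0) (12 * int m + 1) (12 * int m + 1 + ?M)"
    by (subst cnt_reflect[of "\<lambda>s. partial_coeff m (12 * m - 1 - J) s \<noteq> 0"])
       (simp add: add.commute)
  also have "\<dots> = weight m (12 * m - 1 - J)"
    unfolding weight_def
  proof (rule cnt_period)
    show "0 < ?M" by linarith
  qed (simp only: per)
  finally show ?thesis by simp
qed

lemma sum_lessThan_mult_3:
  fixes f :: "nat \<Rightarrow> nat"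
  shows "(\<Sum>j<3 * n. f j) = (\<Sum>i<n. f (3 * i) + f (3 * i + 1) + f (3 * i + 2))"
  by (induction n) (simp_all add: eval_nat_numeral)

text \<open>The symmetry folds the upper half onto the lower one, which is then summed in triples of
  consecutive J.\<close>

lemma sum_weight:
  assumes "0 < m"
  shows "(\<Sum>J<12 * m. weight m J) = 84 * m ^ 2 + 28 * m"
proof -
  have sum_add: "(\<Sum>i<a + b. f i) = (\<Sum>i<a. f i) + (\<Sum>i<b. f (a + i))" for a b and f :: "nat \<Rightarrow> nat"
    by (induction b) simp_all
  have "(\<Sum>J<12 * m. weight m J) = (\<Sum>J<6 * m. weight m J) + (\<Sum>J<6 * m. weight m (6 * m + J))"
    using sum_add[of _ "6 * m" "6 * m"] by simp
  also have "(\<Sum>J<6 * m. weight m (6 * m + J)) = (\<Sum>J<6 * m. weight m J)"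
  proof (rule sum.reindex_bij_witness[of _ "\<lambda>J. 6 * m - 1 - J" "\<lambda>J. 6 * m - 1 - J"])
    fix J assume "J \<in> {..<6 * m}"
    then show "weight m (6 * m - 1 - J) = weight m (6 * m + J)"
      using weight_symmetry[OF assms, of "6 * m + J"] by simp
  qed auto
  also have "(\<Sum>J<6 * m. weight m J) =
      (\<Sum>I<2 * m. weight m (3 * I) + weight m (3 * I + 1) + weight m (3 * I + 2))"
    using sum_lessThan_mult_3[of "weight m" "2 * m"] by simp
  also have "\<dots> = (\<Sum>I<2 * m. if I < m then 24 * I + 22 else 12 * I + 12 * m + 10)"
    by (intro sum.cong refl)
       (simp only: lessThan_iff weight_same,
        auto simp: weight_mod_0_less weight_mod_1_less[simplified] weight_mod_0_ge weight_mod_1_ge[simplified])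
  also have "\<dots> = (\<Sum>i<m. 24 * i + 22) + (\<Sum>i<m. 12 * i + 24 * m + 10)"
    unfolding mult_2[of m] sum_add by (intro arg_cong2[of _ _ _ _ "(+)"] sum.cong) auto
  also have "\<dots> = 42 * m ^ 2 + 14 * m"
  proof -
    have gauss: "2 * (\<Sum>i<m. i) + m = m ^ 2" for m :: nat
      by (induction m) (simp_all add: power2_eq_square)
    have "(\<Sum>i<m. 24 * i + 22) + (\<Sum>i<m. 12 * i + 24 * m + 10) = 36 * (\<Sum>i<m. i) + 32 * m + 24 * m ^ 2"
      by (simp add: sum.distrib sum_distrib_left[symmetric] power2_eq_square)
    then show ?thesis using gauss[of m] by simp
  qed
  finally show ?thesis by simp
qed

section \<open>The Hamming weight\<close>

text \<open>Inside one block J is fixed, and in both applications \<open>a J\<close> is then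
  periodic in the position. Positions become integers because reflections leave the
  naturals.\<close>

lemma hw_blocks:
  assumes coeff: "\<And>n. coeff F n = (of_int (a (n div q) (int n)) :: 'a :: ring_char_0)"
    and a_0: "\<And>J s. K \<le> J \<Longrightarrow> a J s = 0" and "0 < q"
  shows "hw F = (\<Sum>J<K. cnt (\<lambda>s. a J s \<noteq> 0) (int J * int q) (int J * int q + int q))"
proof -
  have "{n. coeff F n \<noteq> 0} = (\<Union>J<K. {n. n div q = J \<and> a J (int n) \<noteq> 0})" (is "_ = (\<Union>J<K. ?S J)")
    using a_0 by (auto simp: coeff not_less[symmetric])
  also have "card \<dots> = (\<Sum>J<K. card (?S J))"
  proof (rule card_UN_disjoint)
    have "?S J \<subseteq> {..<J * q + q}" for J
      using \<open>0 < q\<close> by (auto simp: add.commute[of _ q] dividend_less_div_times)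
    then show "\<forall>J\<in>{..<K}. finite (?S J)"
      by (meson finite_lessThan finite_subset)
  qed auto
  also have "\<dots> = (\<Sum>J<K. cnt (\<lambda>s. a J s \<noteq> 0) (int J * int q) (int J * int q + int q))"
  proof (rule sum.cong[OF refl])
    fix J
    have div: "n div q = J \<longleftrightarrow> int J * int q \<le> int n \<and> int n < int J * int q + int q" for n
    proof -
      have "n div q = J \<longleftrightarrow> J * q \<le> n \<and> n < Suc J * q"
        using \<open>0 < q\<close> div_times_less_eq_dividend[of n q] dividend_less_div_times[of q n]
        by (auto simp: algebra_simps intro!: div_nat_eqI)
      moreover have "int J * int q = int (J * q)" "int J * int q + int q = int (Suc J * q)"
        by simp_all
      ultimately show ?thesis
        by (simp only: of_nat_le_iff of_nat_less_iff)
    qed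
    have nonneg: "0 \<le> s" if "s \<in> {int J * int q..<int J * int q + int q}" for s
      using that by (intro order_trans[of 0 "int J * int q" s]) simp_all
    have "bij_betw int (?S J) ({int J * int q..<int J * int q + int q} \<inter> {s. a J s \<noteq> 0})"
    proof (rule bij_betw_byWitness[of _ nat])
      show "nat ` ({int J * int q..<int J * int q + int q} \<inter> {s. a J s \<noteq> 0}) \<subseteq> ?S J"
      proof safe
        fix s assume s: "s \<in> {int J * int q..<int J * int q + int q}" "a J s \<noteq> 0"
        then have "int (nat s) = s" using nonneg by simp
        then show "nat s div q = J" "a J (int (nat s)) = 0 \<Longrightarrow> False"
          using s by (simp_all add: div)
      qed
      show "\<forall>s\<in>{int J * int q..<int J * int q + int q} \<inter> {s. a J s \<noteq> 0}. int (nat s) = s"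
        using nonneg by simp
    qed (auto simp: div)
    then show "card (?S J) = cnt (\<lambda>s. a J s \<noteq> 0) (int J * int q) (int J * int q + int q)"
      unfolding cnt_def by (rule bij_betw_same_card)
  qed
  finally show ?thesis by (simp add: hw_def)
qed

lemma sum_lessThan_mult_2:
  fixes f :: "nat \<Rightarrow> nat"
  shows "(\<Sum>j<2 * n. f j) = (\<Sum>i<n. f (2 * i) + f (2 * i + 1))"
  by (induction n) (simp_all add: eval_nat_numeral)

text \<open>The range goes beyond the degree 12m because the positions 2J and 2J + 1 with J < 12m
  run up to 24m. The total 8m + 1 is (4p - 1)/3.\<close>

lemma sum_phi_support:
  assumes "0 < m"
  shows "(\<Sum>n<24 * m. of_bool (phi_coeff m n \<noteq> 0) :: nat) = 8 * m + 1"
proof -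
  have "(\<Sum>n<24 * m. of_bool (phi_coeff m n \<noteq> 0) :: nat) =
      (\<Sum>a<8 * m. of_bool (a \<le> 4 * m) + of_bool (a < 2 * m) + of_bool (2 * m \<le> a \<and> a < 4 * m))"
    using sum_lessThan_mult_3[of "\<lambda>n. of_bool (phi_coeff m n \<noteq> 0)" "8 * m"]
    by (simp only: phi_coeff_mult_3) simp
  also have "\<dots> = card ({..<8 * m} \<inter> {a. a \<le> 4 * m}) + card ({..<8 * m} \<inter> {a. a < 2 * m}) +
      card ({..<8 * m} \<inter> {a. 2 * m \<le> a \<and> a < 4 * m})"
    by (simp add: sum.distrib sum_of_bool_eq)
  also have "{..<8 * m} \<inter> {a. a \<le> 4 * m} = {..4 * m}" using assms by auto
  also have "{..<8 * m} \<inter> {a. a < 2 * m} = {..<2 * m}" by auto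
  also have "{..<8 * m} \<inter> {a. 2 * m \<le> a \<and> a < 4 * m} = {2 * m..<4 * m}" by auto
  finally show ?thesis by simp
qed

text \<open>Both 2J and 2J + 1 have half J, so these values are, up to sign, the coefficients of
  Phi_{3p}.\<close>

lemma sum_partial_coeff_diagonal:
  assumes "0 < m"
  shows "(\<Sum>J<12 * m. of_bool (partial_coeff m J (2 * int J) \<noteq> 0) +
           of_bool (partial_coeff m J (2 * int J + 1) \<noteq> 0)) = 8 * m + 1"
proof -
  have "partial_coeff m J (2 * int J) = phi_coeff m (2 * J)"
       "partial_coeff m J (2 * int J + 1) = - phi_coeff m (2 * J + 1)" for J
    using partial_coeff_half[OF assms, of "2 * J"] partial_coeff_half[OF assms, of "2 * J + 1"]
    by (simp_all add: algebra_simps)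
  then show ?thesis
    using sum_phi_support[OF assms] sum_lessThan_mult_2[of "\<lambda>n. of_bool (phi_coeff m n \<noteq> 0)" "12 * m"]
    by simp
qed

lemma partial_coeff_minus_period: "partial_coeff m J (s - k * (18 * int m + 3)) = partial_coeff m J s"
  using partial_coeff_add_period[of m J s "- k"] by simp

lemma hw_cyclotomic_2:
  assumes "0 < m" "p = 6 * m + 1" "prime p" "prime q" "3 < q" "q \<noteq> p"
    and q: "q = k * (18 * m + 3) + 2"
  shows "hw (cyclotomic (3 * p * q)) = k * (84 * m ^ 2 + 28 * m) + (8 * m + 1)"
proof -
  let ?M = "18 * int m + 3"
  have "coeff (cyclotomic (3 * p * q)) n = of_int (partial_coeff m (n div q) (int n))" for n
  proof -
    have "int n - int q * int j = int n - 2 * int j + - (int k * int j) * ?M" for j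
      by (simp add: q algebra_simps)
    then show ?thesis
      unfolding coeff_cyclotomic[OF assms(1-6)] partial_coeff_def by (simp only: inv_coeff_add_period)
  qed
  then have "hw (cyclotomic (3 * p * q)) =
      (\<Sum>J<12 * m. cnt (\<lambda>s. partial_coeff m J s \<noteq> 0) (int J * int q) (int J * int q + int q))"
    by (rule hw_blocks) (use assms in \<open>auto simp: partial_coeff_complete\<close>)
  also have "\<dots> = (\<Sum>J<12 * m. k * weight m J + (of_bool (partial_coeff m J (2 * int J) \<noteq> 0) +
           of_bool (partial_coeff m J (2 * int J + 1) \<noteq> 0)))"
  proof (rule sum.cong[OF refl])
    fix J
    let ?P = "\<lambda>s. partial_coeff m J s \<noteq> 0" and ?a = "int J * int q"
    \<comment> \<open>The two surplus positions are taken at the start of the block, where Jq is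
      congruent to 2J; the other q - 2 positions are k whole periods.\<close>
    have "cnt ?P ?a (?a + int q) = cnt ?P ?a (?a + 1 + 1) + cnt ?P (?a + 2) (?a + int q)"
      using assms(5) cnt_split[of ?a "?a + 1 + 1" "?a + int q" ?P] by (simp add: add.commute)
    also have "cnt ?P (?a + 2) (?a + int q) = k * weight m J"
    proof -
      have "?P (s + ?M) = ?P s" for s
        using partial_coeff_add_period[of m J s 1] by simp
      from cnt_periods[of ?P ?M "?a + 2" k, OF this] show ?thesis
        by (simp add: weight_def q algebra_simps)
    qed
    also have "cnt ?P ?a (?a + 1 + 1) = of_bool (?P ?a) + of_bool (?P (?a + 1))"
      using cnt_Suc[of ?a ?a ?P] cnt_Suc[of ?a "?a + 1" ?P] by (simp add: add.commute)
    also have "partial_coeff m J ?a = partial_coeff m J (2 * int J)"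
      using partial_coeff_add_period[of m J "2 * int J" "int J * int k"]
      by (simp add: q algebra_simps)
    also have "partial_coeff m J (?a + 1) = partial_coeff m J (2 * int J + 1)"
      using partial_coeff_add_period[of m J "2 * int J + 1" "int J * int k"]
      by (simp add: q algebra_simps)
    finally show "cnt ?P ?a (?a + int q) = k * weight m J +
        (of_bool (?P (2 * int J)) + of_bool (?P (2 * int J + 1)))"
      by (simp only: add.commute)
  qed
  also have "\<dots> = k * (\<Sum>J<12 * m. weight m J) + (8 * m + 1)"
    using sum_partial_coeff_diagonal[OF assms(1)] by (simp add: sum.distrib sum_distrib_left)
  finally show ?thesis
    by (simp only: sum_weight[OF assms(1)])
qed

text \<open>Each block is completed to k whole periods by two positions at its end, and their
  contribution stands on the left to avoid subtraction of naturals.\<close>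

lemma hw_cyclotomic_minus_2:
  assumes "0 < m" "p = 6 * m + 1" "prime p" "prime q" "3 < q" "q \<noteq> p"
    and q: "q + 2 = k * (18 * m + 3)"
  shows "hw (cyclotomic (3 * p * q)) + (8 * m + 1) = k * (84 * m ^ 2 + 28 * m)"
proof -
  let ?M = "18 * int m + 3"
  let ?a = "\<lambda>J s. - partial_coeff m J (6 * int m + 3 - s)"
  have q_int: "int q = int k * ?M - 2"
    using arg_cong[OF q, of int] by (simp add: algebra_simps)
  have "coeff (cyclotomic (3 * p * q)) n = of_int (?a (n div q) (int n))" for n
  proof -
    \<comment> \<open>Modulo 3p the argument is n + 2j; the reflection restores the sign of 2j that
      \<open>partial_coeff\<close> expects.\<close>
    have "inv_coeff m (int n - int q * int j) = - inv_coeff m (6 * int m + 3 - int n - 2 * int j)" for j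
    proof -
      have "int n - int q * int j = (6 * int m + 3 - (6 * int m + 3 - int n - 2 * int j)) + - (int k * int j) * ?M"
        by (simp add: q_int algebra_simps)
      then show ?thesis
        by (simp only: inv_coeff_add_period inv_coeff_reflect[OF assms(1)])
    qed
    then show ?thesis
      unfolding coeff_cyclotomic[OF assms(1-6)] partial_coeff_def by (simp add: sum_negf)
  qed
  then have hw: "hw (cyclotomic (3 * p * q)) =
      (\<Sum>J<12 * m. cnt (\<lambda>s. ?a J s \<noteq> 0) (int J * int q) (int J * int q + int q))"
    by (rule hw_blocks) (use assms in \<open>auto simp: partial_coeff_complete\<close>)
  have block: "cnt (\<lambda>s. ?a J s \<noteq> 0) (int J * int q) (int J * int q + int q) +
      (of_bool (partial_coeff m (12 * m - 1 - J) (2 * int (12 * m - 1 - J)) \<noteq> 0) +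
       of_bool (partial_coeff m (12 * m - 1 - J) (2 * int (12 * m - 1 - J) + 1) \<noteq> 0)) = k * weight m J"
    (is "?l + (of_bool ?D + of_bool ?E) = _") if J: "J < 12 * m" for J
  proof -
    let ?P = "\<lambda>s. partial_coeff m J s \<noteq> 0" and ?Q = "\<lambda>s. ?a J s \<noteq> 0"
    let ?b = "int J * int q + int q"
    have per: "?P (s + ?M) = ?P s" for s
      using partial_coeff_add_period[of m J s 1] by simp
    have perQ: "?Q (s + ?M) = ?Q s" for s
      using partial_coeff_minus_period[of m J "6 * int m + 3 - s" 1] by (simp add: algebra_simps)
    have c1: "cnt ?Q (int J * int q) (?b + 1 + 1) = ?l + (of_bool (?Q ?b) + of_bool (?Q (?b + 1)))"
    proof -
      have le: "int J * int q \<le> ?b" "int J * int q \<le> ?b + 1" by simp_all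
      show ?thesis
        by (simp only: cnt_Suc[OF le(1)] cnt_Suc[OF le(2)])
    qed
    have c2: "cnt ?Q (int J * int q) (?b + 1 + 1) = k * cnt ?Q 0 ?M"
      using cnt_periods[of ?Q ?M "int J * int q" k, OF perQ] by (simp add: q_int algebra_simps)
    have c3: "cnt ?Q 0 ?M = weight m J"
    proof -
      have "cnt ?Q 0 ?M = cnt ?P (4 - 12 * int m - 3) (4 - 12 * int m - 3 + ?M)"
        using cnt_reflect[of ?P "6 * int m + 3" 0 ?M] by (simp add: algebra_simps)
      also have "\<dots> = weight m J"
        unfolding weight_def by (rule cnt_period[of ?P, OF per]) simp
      finally show ?thesis .
    qed
    \<comment> \<open>The first added position (J + 1) q is congruent to -2(J + 1) and reflects to
      \<open>?t\<close>; the symmetry in J then maps \<open>?t\<close> to the even diagonal position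
      of block 12m - 1 - J. The next position gives the odd one.\<close>
    have c4: "?Q ?b \<longleftrightarrow> ?D"
    proof -
      let ?t = "6 * int m + 5 + 2 * int J"
      have t: "6 * int m + 3 - ?b = ?t - (int J + 1) * int k * ?M"
        by (simp add: q_int algebra_simps)
      have t': "30 * int m + 3 - ?t = 2 * int (12 * m - 1 - J)"
        using J by (simp add: of_nat_diff)
      show ?thesis
        by (simp only: t partial_coeff_minus_period neg_equal_0_iff_equal
            partial_coeff_symmetry[OF assms(1) J, of ?t, unfolded t', symmetric])
    qed
    have c5: "?Q (?b + 1) \<longleftrightarrow> ?E"
    proof -
      let ?t = "6 * int m + 4 + 2 * int J"
      have t: "6 * int m + 3 - (?b + 1) = ?t - (int J + 1) * int k * ?M"
        by (simp add: q_int algebra_simps)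
      have t': "30 * int m + 3 - ?t = 2 * int (12 * m - 1 - J) + 1"
        using J by (simp add: of_nat_diff)
      show ?thesis
        by (simp only: t partial_coeff_minus_period neg_equal_0_iff_equal
            partial_coeff_symmetry[OF assms(1) J, of ?t, unfolded t', symmetric])
    qed
    show ?thesis
      using c1 unfolding c2 c3 c4 c5 by (rule sym)
  qed
  have diag: "(\<Sum>J<12 * m. of_bool (partial_coeff m (12 * m - 1 - J) (2 * int (12 * m - 1 - J)) \<noteq> 0) +
       of_bool (partial_coeff m (12 * m - 1 - J) (2 * int (12 * m - 1 - J) + 1) \<noteq> 0)) = 8 * m + 1"
    \<comment> \<open>J -> 12m - 1 - J permutes the blocks, so the diagonal total is
      unchanged.\<close>
    unfolding diff_diff_left plus_1_eq_Suc
    by (rule trans[OF sum.nat_diff_reindex[of "\<lambda>J. of_bool (partial_coeff m J (2 * int J) \<noteq> 0) +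
          of_bool (partial_coeff m J (2 * int J + 1) \<noteq> 0)" "12 * m"]
        sum_partial_coeff_diagonal[OF assms(1)]])
  have "hw (cyclotomic (3 * p * q)) + (8 * m + 1) = (\<Sum>J<12 * m. k * weight m J)"
    unfolding hw diag[symmetric] sum.distrib[symmetric]
    by (intro sum.cong refl block) simp
  then show ?thesis
    by (simp only: sum_distrib_left[symmetric] sum_weight[OF assms(1)])
qed

theorem theorem2p1:
  fixes p2 p3 r3 :: nat and N :: real
  assumes "prime p2" and "prime p3"
    and "3 < p2" and "p2 < p3"
    and "[p2 = 1] (mod 3)"
    and "p3 > 3 * p2"
    and "r3 = p3 mod (3 * p2)"
    and "N = 7 * ((real p2)\<^sup>2 - 1) / (9 * real p2)"
  shows "(r3 = 2 \<longrightarrow>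
            real (hw (cyclotomic (3 * p2 * p3))) = N * (real p3 - 2) + (4 * real p2 - 1) / 3) \<and>
         (r3 = 3 * p2 - 2 \<longrightarrow>
            real (hw (cyclotomic (3 * p2 * p3))) = N * (real p3 + 2) - (4 * real p2 - 1) / 3)"
proof -
  define m where "m = p2 div 6"
  have "p2 mod 3 = 1" using assms(5) by (simp add: cong_def)
  moreover have "odd p2" using assms(1,3) prime_odd_nat by auto
  ultimately have "p2 mod 6 = 1" by presburger
  then have p2: "p2 = 6 * m + 1" unfolding m_def by presburger
  then have m: "0 < m" using assms(3) by simp
  have M: "3 * p2 = 18 * m + 3" by (simp add: p2)
  have side: "3 < p3" "p3 \<noteq> p2" using assms(3,4) by auto
  define k where "k = p3 div (3 * p2)"
  have p3: "p3 = k * (18 * m + 3) + r3"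
    unfolding k_def assms(7) M[symmetric] by (rule div_mult_mod_eq[symmetric])
  \<comment> \<open>One period of length 3p = 18m + 3 accounts for 3p N = 84 m^2 + 28 m nonzero
    coefficients.\<close>
  have N: "N * (real l * (18 * real m + 3)) = real l * (84 * real m ^ 2 + 28 * real m)" for l
  proof -
    have "18 * real m + 3 = 3 * real p2" "84 * real m ^ 2 + 28 * real m = 7 * ((real p2)\<^sup>2 - 1) / 3"
      by (simp_all add: p2 power2_eq_square algebra_simps)
    moreover have "N * (real l * (3 * real p2)) = real l * (7 * ((real p2)\<^sup>2 - 1) / 3)"
      using assms(3) by (simp add: assms(8) field_simps)
    ultimately show ?thesis by (simp only:)
  qed
  show ?thesis
  proof (intro conjI impI)
    assume r3: "r3 = 2"
    have "hw (cyclotomic (3 * p2 * p3)) = k * (84 * m ^ 2 + 28 * m) + (8 * m + 1)"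
      using hw_cyclotomic_2[OF m p2 assms(1,2) side] p3 r3 by simp
    moreover have "real p3 - 2 = real k * (18 * real m + 3)" using p3 r3 by simp
    ultimately show "real (hw (cyclotomic (3 * p2 * p3))) = N * (real p3 - 2) + (4 * real p2 - 1) / 3"
      by (simp only: N) (simp add: p2)
  next
    assume r3: "r3 = 3 * p2 - 2"
    \<comment> \<open>The remainder is two short of a full period, so p3 + 2 completes k + 1
      periods.\<close>
    then have p3': "p3 + 2 = (k + 1) * (18 * m + 3)"
      using p3 by (simp add: M)
    have "real (hw (cyclotomic (3 * p2 * p3)) + (8 * m + 1)) = real ((k + 1) * (84 * m ^ 2 + 28 * m))"
      by (simp only: hw_cyclotomic_minus_2[OF m p2 assms(1,2) side p3'])
    then have "real (hw (cyclotomic (3 * p2 * p3))) =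
        real (k + 1) * (84 * real m ^ 2 + 28 * real m) - (8 * real m + 1)"
      by (simp only: of_nat_add of_nat_mult of_nat_power of_nat_numeral of_nat_1 eq_diff_eq)
    also have "\<dots> = N * (real (k + 1) * (18 * real m + 3)) - (4 * real p2 - 1) / 3"
      by (simp only: N) (simp add: p2 add_divide_distrib)
    also have "real (k + 1) * (18 * real m + 3) = real p3 + 2"
      using arg_cong[OF p3', of real] by (simp add: algebra_simps)
    finally show "real (hw (cyclotomic (3 * p2 * p3))) = N * (real p3 + 2) - (4 * real p2 - 1) / 3" .
  qed
qed

end
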